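(* There exist finitely generated groups that are very-flexibly stable in the operator norm but not flexibly stable in the operator norm.
   Context: For $n\in\mathbb{N}$, let $M_n=M_n(\mathbb{C})$, let $\mathcal{U}_n$ be the group of $n\times n$ unitary matrices, and let $\|\cdot\|$ denote the operator norm. Let $\Gamma$ be a countable discrete group. An asymptotic representation of $\Gamma$ in the operator norm is a sequence of maps $\varphi_n\colon\Gamma\to\mathcal{U}_{d_n}$ (with $(d_n)$ a sequence of positive integers) such that $\|\varphi_n(gh)-\varphi_n(g)\varphi_n(h)\|\to 0$ for every $g,h\in\Gamma$. The group $\Gamma$ is flexibly stable (respectively, very-flexibly stable) in the operator norm if, for every asymptotic representation $(\varphi_n)$ of $\Gamma$ in the operator norm, there exist integers $k_n\ge d_n$, isometries $W_n\colon\mathbb{C}^{d_n}\to\mathbb{C}^{k_n}$, and genuine unitary representations (group homomorphisms) $\pi_n\colon\Gamma\to\mathcal{U}_{k_n}$ such that $\|W_n^*\pi_n(g)W_n-\varphi_n(g)\|\to 0$ for every $g\in\Gamma$, subject to the constraint $k_n/d_n\to 1$ for flexible stability (respectively, with no restriction on $k_n/d_n$ for very-flexible stability). *)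

theory Defs
  imports
    "HOL-Algebra.Generated_Groups"
    "HOL-Analysis.L2_Norm"
    "Jordan_Normal_Form.Schur_Decomposition"
begin

definition l2_norm :: "complex vec \<Rightarrow> real" where
  "l2_norm v = L2_set (\<lambda>i. cmod (v $ i)) {..<dim_vec v}"

definition op_norm :: "complex mat \<Rightarrow> real" where
  "op_norm A = (SUP v \<in> {v \<in> carrier_vec (dim_col A). l2_norm v \<le> 1}. l2_norm (A *\<^sub>v v))"

text \<open>The supremum of reals above is over a nonempty, bounded set, so it is not a junk value.\<close>

lemma op_norm_nonempty: "{v \<in> carrier_vec n. l2_norm v \<le> 1} \<noteq> {}"
proof -
  have "0\<^sub>v n \<in> {v \<in> carrier_vec n. l2_norm v \<le> 1}"
    by (simp add: l2_norm_def L2_set_def)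
  then show ?thesis by blast
qed

lemma op_norm_bdd_above:
  "bdd_above ((\<lambda>v. l2_norm (A *\<^sub>v v)) ` {v \<in> carrier_vec (dim_col A). l2_norm v \<le> 1})"
proof (rule bdd_aboveI2)
  fix v :: "complex vec"
  assume "v \<in> {v \<in> carrier_vec (dim_col A). l2_norm v \<le> 1}"
  then have v: "dim_vec v = dim_col A" "l2_norm v \<le> 1" by auto
  have entry: "cmod (v $ j) \<le> 1" if "j < dim_col A" for j
    using member_le_L2_set[of "{..<dim_vec v}" j "\<lambda>i. cmod (v $ i)"] that v
    by (simp add: l2_norm_def)
  have "l2_norm (A *\<^sub>v v) \<le> (\<Sum>i<dim_row A. cmod ((A *\<^sub>v v) $ i))"
    unfolding l2_norm_def dim_mult_mat_vec by (rule L2_set_le_sum) simp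
  also have "\<dots> \<le> (\<Sum>i<dim_row A. \<Sum>j<dim_col A. cmod (A $$ (i, j)))"
  proof (rule sum_mono)
    fix i assume i: "i \<in> {..<dim_row A}"
    have "cmod ((A *\<^sub>v v) $ i) = cmod (\<Sum>j<dim_col A. A $$ (i, j) * v $ j)"
      using i v by (simp add: scalar_prod_def lessThan_atLeast0)
    also have "\<dots> \<le> (\<Sum>j<dim_col A. cmod (A $$ (i, j) * v $ j))"
      by (rule norm_sum)
    also have "\<dots> \<le> (\<Sum>j<dim_col A. cmod (A $$ (i, j)))"
      by (intro sum_mono) (simp add: norm_mult mult_left_le entry)
    finally show "cmod ((A *\<^sub>v v) $ i) \<le> (\<Sum>j<dim_col A. cmod (A $$ (i, j)))" .
  qed
  finally show "l2_norm (A *\<^sub>v v) \<le> (\<Sum>i<dim_row A. \<Sum>j<dim_col A. cmod (A $$ (i, j)))" .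
qed

definition isometry_mats :: "nat \<Rightarrow> nat \<Rightarrow> complex mat set" where
  "isometry_mats d k = {W \<in> carrier_mat k d. mat_adjoint W * W = 1\<^sub>m d}"

definition unitary_group :: "nat \<Rightarrow> complex mat monoid" where
  "unitary_group n =
    \<lparr>carrier = {U \<in> carrier_mat n n. mat_adjoint U * U = 1\<^sub>m n \<and> U * mat_adjoint U = 1\<^sub>m n},
     monoid.mult = (*), one = 1\<^sub>m n\<rparr>"

lemma mat_adjoint_dim: "A \<in> carrier_mat n m \<Longrightarrow> mat_adjoint A \<in> carrier_mat m n"
  by (auto simp: mat_adjoint_def)

lemma mat_adjoint_index:
  "i < dim_col A \<Longrightarrow> j < dim_row A \<Longrightarrow> mat_adjoint A $$ (i, j) = cnj (A $$ (j, i))"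
  by (simp add: mat_adjoint_def mat_of_rows_def)

lemma mat_adjoint_one: "mat_adjoint (1\<^sub>m n :: complex mat) = 1\<^sub>m n"
proof (rule eq_matI)
  show "mat_adjoint (1\<^sub>m n :: complex mat) $$ (i, j) = 1\<^sub>m n $$ (i, j)"
    if "i < dim_row (1\<^sub>m n :: complex mat)" "j < dim_col (1\<^sub>m n :: complex mat)" for i j
    using that by (simp add: mat_adjoint_index)
qed (simp_all add: mat_adjoint_def)

lemma mat_adjoint_adjoint: "mat_adjoint (mat_adjoint A) = (A :: complex mat)"
proof (rule eq_matI)
  have d: "dim_row (mat_adjoint A) = dim_col A" "dim_col (mat_adjoint A) = dim_row A"
    by (auto simp: mat_adjoint_def)
  then show "dim_row (mat_adjoint (mat_adjoint A)) = dim_row A"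
    "dim_col (mat_adjoint (mat_adjoint A)) = dim_col A"
    by (auto simp: mat_adjoint_def)
  show "mat_adjoint (mat_adjoint A) $$ (i, j) = A $$ (i, j)"
    if "i < dim_row A" "j < dim_col A" for i j
    using that d by (simp add: mat_adjoint_index)
qed

lemma mat_adjoint_mult:
  assumes "A \<in> carrier_mat n m" "B \<in> carrier_mat m l"
  shows "mat_adjoint (A * B) = mat_adjoint B * (mat_adjoint A :: complex mat)"
proof (rule eq_matI)
  have A': "mat_adjoint A \<in> carrier_mat m n" and B': "mat_adjoint B \<in> carrier_mat l m"
    and AB': "mat_adjoint (A * B) \<in> carrier_mat l n"
    using assms by (auto intro!: mat_adjoint_dim)
  then show "dim_row (mat_adjoint (A * B)) = dim_row (mat_adjoint B * mat_adjoint A)"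
    "dim_col (mat_adjoint (A * B)) = dim_col (mat_adjoint B * mat_adjoint A)"
    by auto
  fix i j
  assume "i < dim_row (mat_adjoint B * mat_adjoint A)" "j < dim_col (mat_adjoint B * mat_adjoint A)"
  then have ij: "i < l" "j < n" using A' B' by auto
  then show "mat_adjoint (A * B) $$ (i, j) = (mat_adjoint B * mat_adjoint A) $$ (i, j)"
    using assms A' B'
    by (auto simp: mat_adjoint_index scalar_prod_def mult.commute intro!: sum.cong)
qed

lemma group_unitary_group: "group (unitary_group n)"
proof (rule groupI)
  fix U V assume "U \<in> carrier (unitary_group n)" "V \<in> carrier (unitary_group n)"
  then have U: "U \<in> carrier_mat n n" "mat_adjoint U * U = 1\<^sub>m n" "U * mat_adjoint U = 1\<^sub>m n"
    and V: "V \<in> carrier_mat n n" "mat_adjoint V * V = 1\<^sub>m n" "V * mat_adjoint V = 1\<^sub>m n"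
    by (auto simp: unitary_group_def)
  have U': "mat_adjoint U \<in> carrier_mat n n" and V': "mat_adjoint V \<in> carrier_mat n n"
    using U V by (auto intro: mat_adjoint_dim)
  have adj: "mat_adjoint (U * V) = mat_adjoint V * mat_adjoint U"
    using U V by (intro mat_adjoint_mult)
  have "mat_adjoint (U * V) * (U * V) = mat_adjoint V * (mat_adjoint U * (U * V))"
    unfolding adj using U V U' V' by (intro assoc_mult_mat) auto
  also have "mat_adjoint U * (U * V) = (mat_adjoint U * U) * V"
    using U V U' V' by (intro assoc_mult_mat[symmetric]) auto
  finally have 1: "mat_adjoint (U * V) * (U * V) = 1\<^sub>m n" using U V by simp
  have "(U * V) * mat_adjoint (U * V) = U * (V * (mat_adjoint V * mat_adjoint U))"
    unfolding adj using U V U' V' by (intro assoc_mult_mat) auto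
  also have "V * (mat_adjoint V * mat_adjoint U) = (V * mat_adjoint V) * mat_adjoint U"
    using U V U' V' by (intro assoc_mult_mat[symmetric]) auto
  finally have 2: "(U * V) * mat_adjoint (U * V) = 1\<^sub>m n" using U V U' by simp
  show "U \<otimes>\<^bsub>unitary_group n\<^esub> V \<in> carrier (unitary_group n)"
    using 1 2 U V by (simp add: unitary_group_def)
next
  show "\<one>\<^bsub>unitary_group n\<^esub> \<in> carrier (unitary_group n)"
    by (simp add: unitary_group_def mat_adjoint_one)
next
  fix U assume U: "U \<in> carrier (unitary_group n)"
  then have "mat_adjoint U \<in> carrier (unitary_group n)"
    by (simp add: unitary_group_def mat_adjoint_adjoint mat_adjoint_dim)
  then show "\<exists>V\<in>carrier (unitary_group n). V \<otimes>\<^bsub>unitary_group n\<^esub> U = \<one>\<^bsub>unitary_group n\<^esub>"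
    using U by (intro bexI[of _ "mat_adjoint U"]) (auto simp: unitary_group_def)
qed (auto simp: unitary_group_def intro: assoc_mult_mat)

text \<open>Finitely generated groups are countable, so up to isomorphism their carriers are sets of
  natural numbers.\<close>

definition finitely_generated :: "('a, 'b) monoid_scheme \<Rightarrow> bool" where
  "finitely_generated G \<longleftrightarrow> (\<exists>S. finite S \<and> S \<subseteq> carrier G \<and> generate G S = carrier G)"

definition asymptotic_representation ::
  "('a, 'b) monoid_scheme \<Rightarrow> (nat \<Rightarrow> nat) \<Rightarrow> (nat \<Rightarrow> 'a \<Rightarrow> complex mat) \<Rightarrow> bool" where
  "asymptotic_representation G d \<phi> \<longleftrightarrow>
    (\<forall>n. d n > 0) \<and>
    (\<forall>n. \<phi> n \<in> carrier G \<rightarrow> carrier (unitary_group (d n))) \<and>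
    (\<forall>g\<in>carrier G. \<forall>h\<in>carrier G.
      (\<lambda>n. op_norm (\<phi> n (g \<otimes>\<^bsub>G\<^esub> h) - \<phi> n g * \<phi> n h)) \<longlonglongrightarrow> 0)"

definition asymptotically_compresses ::
  "('a, 'b) monoid_scheme \<Rightarrow> (nat \<Rightarrow> nat) \<Rightarrow> (nat \<Rightarrow> 'a \<Rightarrow> complex mat) \<Rightarrow>
   (nat \<Rightarrow> nat) \<Rightarrow> (nat \<Rightarrow> complex mat) \<Rightarrow> (nat \<Rightarrow> 'a \<Rightarrow> complex mat) \<Rightarrow> bool" where
  "asymptotically_compresses G d \<phi> k W \<pi> \<longleftrightarrow>
    (\<forall>n. d n \<le> k n) \<and>
    (\<forall>n. W n \<in> isometry_mats (d n) (k n)) \<and>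
    (\<forall>n. \<pi> n \<in> hom G (unitary_group (k n))) \<and>
    (\<forall>g\<in>carrier G. (\<lambda>n. op_norm (mat_adjoint (W n) * \<pi> n g * W n - \<phi> n g)) \<longlonglongrightarrow> 0)"

definition flexibly_stable :: "('a, 'b) monoid_scheme \<Rightarrow> bool" where
  "flexibly_stable G \<longleftrightarrow>
    (\<forall>d \<phi>. asymptotic_representation G d \<phi> \<longrightarrow>
      (\<exists>k W \<pi>. asymptotically_compresses G d \<phi> k W \<pi> \<and>
        (\<lambda>n. real (k n) / real (d n)) \<longlonglongrightarrow> 1))"

definition very_flexibly_stable :: "('a, 'b) monoid_scheme \<Rightarrow> bool" where
  "very_flexibly_stable G \<longleftrightarrow>
    (\<forall>d \<phi>. asymptotic_representation G d \<phi> \<longrightarrow>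
      (\<exists>k W \<pi>. asymptotically_compresses G d \<phi> k W \<pi>))"

end

theory Submission
  imports
    Defs
    "HOL-Combinatorics.Permutations"
    "HOL-Library.Countable_Set"
begin

text \<open>
  The group \<open>\<Gamma>\<close> is a group of permutations of \<open>W\<^sub>k = {- h\<^sub>k..h\<^sub>k} \<times> {True, False}\<close> for all \<open>k\<close> at once,
  where \<open>2 h\<^sub>k + 1 = 3\<^sup>k\<^sup>+\<^sup>2\<close>.  It is generated by the rotation \<open>t\<close> of the cycle obtained by gluing the
  two copies end to end, and the transpositions of \<open>0\<close> and \<open>1\<close> in either copy.  For large \<open>k\<close>, each
  element acts on \<open>W\<^sub>k\<close> as a fixed finitary permutation preserving the copies followed by a rotation,
  so \<open>\<Gamma>\<close> is residually finite and (locally finite)-by-\<open>\<int>\<close>, hence amenable.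

  Very-flexible stability: for a Foelner set \<open>F\<close> and a finite quotient \<open>q : \<Gamma> \<rightarrow> Q\<close> injective on \<open>F\<close>, the
  isometry \<open>v \<mapsto> |F|\<^sup>-\<^sup>1\<^sup>/\<^sup>2 \<Sum>\<^sub>f \<delta>\<^bsub>q f\<^esub> \<otimes> \<phi>(f)\<^sup>* v\<close> compresses \<open>\<lambda>\<^sub>Q \<otimes> 1\<close> to approximately \<open>\<phi>\<close>.

  No flexible stability: let \<open>x\<close> and \<open>y\<close> be the 3-cycles on \<open>0, 1, 2\<close> in the two copies.  Since \<open>t\<close> to
  the power \<open>3\<^sup>K\<^sup>+\<^sup>2\<close> exchanges the copies of \<open>W\<^sub>k\<close> for \<open>k \<le> K\<close>, \<open>x\<close> is conjugate to \<open>y\<close> up to an element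
  supported on the \<open>W\<^sub>k\<close> with \<open>k > K\<close>, and every finite-dimensional unitary representation kills that
  element for some \<open>K\<close>.  So all these representations have equal traces at \<open>x\<close> and \<open>y\<close>.  But forgetting
  the second copy gives asymptotic homomorphisms to finite groups trivial on \<open>y\<close> but not on \<open>x\<close>, and
  the normalised traces of their regular representations are 0 at \<open>x\<close> and 1 at \<open>y\<close>.
\<close>

section \<open>Operator norm estimates\<close>

lemma l2_norm_nonneg [simp]: "0 \<le> l2_norm v"
  by (simp add: l2_norm_def)

lemma l2_norm_power2: "(l2_norm v)\<^sup>2 = (\<Sum>i<dim_vec v. (cmod (v $ i))\<^sup>2)"
  by (simp add: l2_norm_def L2_set_def sum_nonneg)

lemma l2_norm_mult_le_op_norm:
  assumes "v \<in> carrier_vec (dim_col A)" "l2_norm v \<le> 1"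
  shows "l2_norm (A *\<^sub>v v) \<le> op_norm A"
  unfolding op_norm_def by (rule cSUP_upper[OF _ op_norm_bdd_above]) (use assms in auto)

lemma op_norm_le:
  assumes "\<And>v. v \<in> carrier_vec (dim_col A) \<Longrightarrow> l2_norm v \<le> 1 \<Longrightarrow> l2_norm (A *\<^sub>v v) \<le> C"
  shows "op_norm A \<le> C"
  unfolding op_norm_def by (rule cSUP_least[OF op_norm_nonempty]) (use assms in auto)

lemma op_norm_nonneg [simp]: "0 \<le> op_norm A"
proof -
  have "l2_norm (A *\<^sub>v 0\<^sub>v (dim_col A)) \<le> op_norm A"
    by (rule l2_norm_mult_le_op_norm) (auto simp: l2_norm_def L2_set_def)
  then show ?thesis using l2_norm_nonneg order_trans by blast
qed

lemma op_norm_zero_mat [simp]: "op_norm (0\<^sub>m n m) = 0"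
proof -
  have "op_norm (0\<^sub>m n m) \<le> 0"
    by (rule op_norm_le) (auto simp: l2_norm_def L2_set_def)
  then show ?thesis by (simp add: antisym)
qed

text \<open>Apply \<open>A\<close> to a standard unit vector and read off one coordinate. This is
  the link from operator norms to traces.\<close>

lemma cmod_entry_le_op_norm:
  assumes "i < dim_row A" "j < dim_col A"
  shows "cmod (A $$ (i, j)) \<le> op_norm A"
proof -
  have "l2_norm (unit_vec (dim_col A) j) = 1"
    using assms by (simp add: l2_norm_def L2_set_def unit_vec_def if_distrib[of cmod] if_distrib[of "\<lambda>x. x\<^sup>2"] sum.delta cong: if_cong)
  then have "l2_norm (A *\<^sub>v unit_vec (dim_col A) j) \<le> op_norm A"
    by (intro l2_norm_mult_le_op_norm) auto
  moreover have "cmod ((A *\<^sub>v unit_vec (dim_col A) j) $ i) \<le> l2_norm (A *\<^sub>v unit_vec (dim_col A) j)"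
    unfolding l2_norm_def using assms by (intro member_le_L2_set) auto
  ultimately show ?thesis using assms by (simp add: scalar_prod_right_unit)
qed

lemma l2_norm_isometry:
  assumes "W \<in> carrier_mat k d" "mat_adjoint W * W = 1\<^sub>m d" "v \<in> carrier_vec d"
  shows "l2_norm (W *\<^sub>v v) = l2_norm v"
proof -
  have sq: "complex_of_real ((cmod z)\<^sup>2) = z * cnj z" for z :: complex
    using complex_norm_square by metis
  have aux: "complex_of_real ((l2_norm w)\<^sup>2) = (\<Sum>i<dim_vec w. w $ i * cnj (w $ i))" for w
    by (simp add: l2_norm_power2 sq del: of_real_power)
  have W: "dim_row W = k" "dim_col W = d" using assms by auto
  \<comment> \<open>The entries of \<open>mat_adjoint W * W = 1\<^sub>m d\<close> say that the
    columns of \<open>W\<close> are orthonormal.\<close>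
  have orth: "(\<Sum>i<k. cnj (W $$ (i, b)) * W $$ (i, a)) = (if a = b then 1 else 0)"
    if "a < d" "b < d" for a b
  proof -
    have "(mat_adjoint W * W) $$ (b, a) = (\<Sum>i<k. cnj (W $$ (i, b)) * W $$ (i, a))"
      using assms(1) that mat_adjoint_dim[OF assms(1)]
      by (auto simp: scalar_prod_def mat_adjoint_index lessThan_atLeast0 intro!: sum.cong)
    then show ?thesis using assms(2) that by auto
  qed
  have "complex_of_real ((l2_norm (W *\<^sub>v v))\<^sup>2) =
      (\<Sum>i<k. (\<Sum>a<d. W $$ (i, a) * v $ a) * cnj (\<Sum>b<d. W $$ (i, b) * v $ b))"
    unfolding aux using assms by (auto simp: scalar_prod_def lessThan_atLeast0 intro!: sum.cong)
  also have "\<dots> = (\<Sum>i<k. \<Sum>a<d. \<Sum>b<d. (v $ a * cnj (v $ b)) * (cnj (W $$ (i, b)) * W $$ (i, a)))"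
    by (simp add: sum_product mult.commute mult.left_commute mult.assoc)
  also have "\<dots> = (\<Sum>a<d. \<Sum>b<d. \<Sum>i<k. (v $ a * cnj (v $ b)) * (cnj (W $$ (i, b)) * W $$ (i, a)))"
    by (subst sum.swap, rule sum.cong[OF refl], rule sum.swap)
  also have "\<dots> = (\<Sum>a<d. \<Sum>b<d. (v $ a * cnj (v $ b)) * (if a = b then 1 else 0))"
    by (intro sum.cong refl) (simp add: sum_distrib_left[symmetric] orth)
  also have "\<dots> = (\<Sum>a<d. v $ a * cnj (v $ a))"
    by (intro sum.cong refl) (simp add: if_distrib[of "(*) _"] cong: if_cong)
  also have "\<dots> = complex_of_real ((l2_norm v)\<^sup>2)"
    unfolding aux using assms(3) by simp
  finally have "(l2_norm (W *\<^sub>v v))\<^sup>2 = (l2_norm v)\<^sup>2" using of_real_eq_iff by blast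
  then show ?thesis by (simp add: power2_eq_iff_nonneg)
qed

lemma op_norm_mult_unitary_le:
  assumes "A \<in> carrier_mat n d" "U \<in> carrier_mat d d" "mat_adjoint U * U = 1\<^sub>m d"
  shows "op_norm (A * U) \<le> op_norm A"
proof (rule op_norm_le)
  fix v assume v: "v \<in> carrier_vec (dim_col (A * U))" "l2_norm v \<le> 1"
  then have v': "v \<in> carrier_vec d" using assms by auto
  have "l2_norm (A *\<^sub>v (U *\<^sub>v v)) \<le> op_norm A"
    using assms v' v by (intro l2_norm_mult_le_op_norm) (auto simp: l2_norm_isometry)
  then show "l2_norm (A * U *\<^sub>v v) \<le> op_norm A"
    using assms v' by (simp add: assoc_mult_mat_vec)
qed

lemma L2_set_cmod_sum_le:
  assumes "finite F"
  shows "L2_set (\<lambda>i. cmod (\<Sum>f\<in>F. c f i)) I \<le> (\<Sum>f\<in>F. L2_set (\<lambda>i. cmod (c f i)) I)"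
  using assms
proof (induction F)
  case (insert f F)
  have "L2_set (\<lambda>i. cmod (\<Sum>f\<in>insert f F. c f i)) I
      \<le> L2_set (\<lambda>i. cmod (c f i) + cmod (\<Sum>f\<in>F. c f i)) I"
    using insert by (intro L2_set_mono) (auto simp: norm_triangle_ineq)
  also have "\<dots> \<le> L2_set (\<lambda>i. cmod (c f i)) I + L2_set (\<lambda>i. cmod (\<Sum>f\<in>F. c f i)) I"
    by (rule L2_set_triangle_ineq)
  finally show ?case using insert by simp
qed (simp add: L2_set_def)

text \<open>Averages are stated entrywise, as \<^const>\<open>sum\<close> is not available on matrices of
  variable dimension.\<close>

lemma op_norm_average_le:
  assumes "finite F" "F \<noteq> {}" "A \<in> carrier_mat n m" "\<And>f. f \<in> F \<Longrightarrow> B f \<in> carrier_mat n m"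
    and "\<And>i j. i < n \<Longrightarrow> j < m \<Longrightarrow> A $$ (i, j) = (\<Sum>f\<in>F. B f $$ (i, j)) / of_nat (card F)"
  shows "op_norm A \<le> (\<Sum>f\<in>F. op_norm (B f)) / card F"
proof (rule op_norm_le)
  fix v assume v: "v \<in> carrier_vec (dim_col A)" "l2_norm v \<le> 1"
  then have v': "v \<in> carrier_vec m" using assms by auto
  define N where "N = complex_of_nat (card F)"
  have N: "cmod N = real (card F)" by (simp add: N_def)
  have pos: "real (card F) > 0" using assms by (simp add: card_gt_0_iff)
  have "(A *\<^sub>v v) $ i = (\<Sum>f\<in>F. (B f *\<^sub>v v) $ i / N)" if "i < n" for i
  proof -
    have "(A *\<^sub>v v) $ i = (\<Sum>j<m. (\<Sum>f\<in>F. B f $$ (i, j)) / N * v $ j)"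
      using assms that v' by (auto simp: scalar_prod_def lessThan_atLeast0 N_def intro!: sum.cong)
    also have "\<dots> = (\<Sum>j<m. \<Sum>f\<in>F. B f $$ (i, j) * v $ j / N)"
      by (simp add: sum_distrib_right sum_divide_distrib)
    also have "\<dots> = (\<Sum>f\<in>F. \<Sum>j<m. B f $$ (i, j) * v $ j / N)"
      by (rule sum.swap)
    also have "\<dots> = (\<Sum>f\<in>F. (B f *\<^sub>v v) $ i / N)"
    proof (rule sum.cong[OF refl])
      fix f assume "f \<in> F"
      then show "(\<Sum>j<m. B f $$ (i, j) * v $ j / N) = (B f *\<^sub>v v) $ i / N"
        using assms(4)[of f] that v'
        by (auto simp: scalar_prod_def lessThan_atLeast0 sum_divide_distrib)
    qed
    finally show ?thesis .
  qed
  then have "l2_norm (A *\<^sub>v v) = L2_set (\<lambda>i. cmod (\<Sum>f\<in>F. (B f *\<^sub>v v) $ i / N)) {..<n}"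
    unfolding l2_norm_def using assms(3) by (intro L2_set_cong) auto
  also have "\<dots> \<le> (\<Sum>f\<in>F. L2_set (\<lambda>i. cmod ((B f *\<^sub>v v) $ i / N)) {..<n})"
    by (rule L2_set_cmod_sum_le[OF assms(1)])
  also have "\<dots> = (\<Sum>f\<in>F. l2_norm (B f *\<^sub>v v) / card F)"
  proof (rule sum.cong[OF refl])
    fix f assume f: "f \<in> F"
    have "L2_set (\<lambda>i. cmod ((B f *\<^sub>v v) $ i / N)) {..<n}
        = L2_set (\<lambda>i. (1 / card F) * cmod ((B f *\<^sub>v v) $ i)) {..<n}"
      by (intro L2_set_cong) (auto simp: norm_divide N)
    also have "\<dots> = l2_norm (B f *\<^sub>v v) / card F"
      using assms(4)[OF f] pos by (subst L2_set_right_distrib[symmetric]) (auto simp: l2_norm_def)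
    finally show "L2_set (\<lambda>i. cmod ((B f *\<^sub>v v) $ i / N)) {..<n} = l2_norm (B f *\<^sub>v v) / card F" .
  qed
  also have "\<dots> \<le> (\<Sum>f\<in>F. op_norm (B f) / card F)"
    using assms(4) v v' pos
    by (intro sum_mono divide_right_mono l2_norm_mult_le_op_norm) auto
  finally show "l2_norm (A *\<^sub>v v) \<le> (\<Sum>f\<in>F. op_norm (B f)) / card F"
    by (simp add: sum_divide_distrib)
qed

text \<open>The hypotheses bound images of unit vectors instead of operator norms, so a product of
  contractions can be handled one factor at a time.\<close>

lemma op_norm_diff_le:
  assumes "A \<in> carrier_mat n m" "B \<in> carrier_mat n m"
    and "\<And>v. v \<in> carrier_vec m \<Longrightarrow> l2_norm v \<le> 1 \<Longrightarrow> l2_norm (A *\<^sub>v v) \<le> a"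
    and "\<And>v. v \<in> carrier_vec m \<Longrightarrow> l2_norm v \<le> 1 \<Longrightarrow> l2_norm (B *\<^sub>v v) \<le> b"
  shows "op_norm (A - B) \<le> a + b"
proof (rule op_norm_le)
  fix v assume v: "v \<in> carrier_vec (dim_col (A - B))" "l2_norm v \<le> 1"
  then have v': "v \<in> carrier_vec m" using assms by auto
  have "l2_norm ((A - B) *\<^sub>v v) = L2_set (\<lambda>i. cmod ((A *\<^sub>v v) $ i - (B *\<^sub>v v) $ i)) {..<n}"
    using assms v' by (auto simp: l2_norm_def minus_mult_distrib_mat_vec intro!: L2_set_cong)
  also have "\<dots> \<le> L2_set (\<lambda>i. cmod ((A *\<^sub>v v) $ i) + cmod ((B *\<^sub>v v) $ i)) {..<n}"
    by (intro L2_set_mono) (auto simp: norm_triangle_ineq4)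
  also have "\<dots> \<le> L2_set (\<lambda>i. cmod ((A *\<^sub>v v) $ i)) {..<n} + L2_set (\<lambda>i. cmod ((B *\<^sub>v v) $ i)) {..<n}"
    by (rule L2_set_triangle_ineq)
  also have "\<dots> = l2_norm (A *\<^sub>v v) + l2_norm (B *\<^sub>v v)"
    using assms by (auto simp: l2_norm_def)
  also have "\<dots> \<le> a + b" using assms v' v by (intro add_mono) auto
  finally show "l2_norm ((A - B) *\<^sub>v v) \<le> a + b" .
qed

section \<open>Frobenius norm and traces\<close>

text \<open>The square of the Hilbert-Schmidt norm, neither normalised nor rooted, so that it equals
  the trace of \<open>mat_adjoint A * A\<close>.\<close>

definition frob :: "complex mat \<Rightarrow> real" where
  "frob A = (\<Sum>i<dim_row A. \<Sum>j<dim_col A. (cmod (A $$ (i, j)))\<^sup>2)"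

definition mat_trace :: "complex mat \<Rightarrow> complex" where
  "mat_trace A = (\<Sum>i<dim_row A. A $$ (i, i))"

lemma mult_mat_index_sum:
  assumes "A \<in> carrier_mat n m" "B \<in> carrier_mat m l" "i < n" "j < l"
  shows "(A * B) $$ (i, j) = (\<Sum>a<m. A $$ (i, a) * B $$ (a, j))"
  using assms by (auto simp: scalar_prod_def lessThan_atLeast0 intro!: sum.cong)

lemma mat_trace_comm:
  assumes "A \<in> carrier_mat n m" "B \<in> carrier_mat m n"
  shows "mat_trace (A * B) = mat_trace (B * A)"
proof -
  have "mat_trace (A * B) = (\<Sum>i<n. \<Sum>a<m. A $$ (i, a) * B $$ (a, i))"
    unfolding mat_trace_def using assms
    by (auto simp: mult_mat_index_sum[OF assms] simp del: index_mult_mat(1) intro!: sum.cong)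
  also have "\<dots> = (\<Sum>a<m. \<Sum>i<n. B $$ (a, i) * A $$ (i, a))"
    by (subst sum.swap) (simp add: mult.commute)
  also have "\<dots> = mat_trace (B * A)"
    unfolding mat_trace_def using assms
    by (auto simp: mult_mat_index_sum[OF assms(2,1)] simp del: index_mult_mat(1) intro!: sum.cong)
  finally show ?thesis .
qed

lemma mat_trace_minus:
  assumes "A \<in> carrier_mat n n" "B \<in> carrier_mat n n"
  shows "mat_trace (A - B) = mat_trace A - mat_trace B"
  using assms by (auto simp: mat_trace_def sum_subtractf)

lemma mat_trace_one [simp]: "mat_trace (1\<^sub>m n) = of_nat n"
  by (simp add: mat_trace_def)

text \<open>There are \<open>n\<close> diagonal entries, each at most \<open>op_norm A\<close>.
  Closeness in operator norm thus becomes closeness of traces divided by the dimension.\<close>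

lemma cmod_mat_trace_le:
  assumes "A \<in> carrier_mat n n"
  shows "cmod (mat_trace A) \<le> n * op_norm A"
proof -
  have "cmod (mat_trace A) \<le> (\<Sum>i<n. cmod (A $$ (i, i)))"
    unfolding mat_trace_def using assms by (auto intro: norm_sum)
  also have "\<dots> \<le> (\<Sum>i<n. op_norm A)"
    using assms by (intro sum_mono cmod_entry_le_op_norm) auto
  finally show ?thesis by simp
qed

lemma frob_eq_trace:
  assumes "A \<in> carrier_mat n m"
  shows "complex_of_real (frob A) = mat_trace (mat_adjoint A * A)"
proof -
  have "mat_trace (mat_adjoint A * A) = (\<Sum>j<m. \<Sum>i<n. cnj (A $$ (i, j)) * A $$ (i, j))"
    using assms mat_adjoint_dim[OF assms]
    by (auto simp: mat_trace_def mat_adjoint_index mult_mat_index_sum[OF mat_adjoint_dim[OF assms] assms]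
        simp del: index_mult_mat(1) intro!: sum.cong)
  also have "\<dots> = (\<Sum>i<n. \<Sum>j<m. complex_of_real ((cmod (A $$ (i, j)))\<^sup>2))"
    by (subst sum.swap) (simp add: complex_norm_square mult.commute del: of_real_power)
  also have "\<dots> = complex_of_real (frob A)"
    using assms by (simp add: frob_def)
  finally show ?thesis by simp
qed

lemma frob_mat_adjoint:
  assumes "A \<in> carrier_mat n m"
  shows "frob (mat_adjoint A) = frob A"
proof -
  have "frob (mat_adjoint A) = (\<Sum>i<m. \<Sum>j<n. (cmod (A $$ (j, i)))\<^sup>2)"
    using assms mat_adjoint_dim[OF assms] by (auto simp: frob_def mat_adjoint_index intro!: sum.cong)
  also have "\<dots> = frob A"
    using assms by (subst sum.swap) (auto simp: frob_def)
  finally show ?thesis .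
qed

lemma frob_isometry_mult:
  assumes "U \<in> carrier_mat k n" "mat_adjoint U * U = 1\<^sub>m n" "A \<in> carrier_mat n m"
  shows "frob (U * A) = frob A"
proof -
  have U': "mat_adjoint U \<in> carrier_mat n k" and A': "mat_adjoint A \<in> carrier_mat m n"
    using assms by (auto intro: mat_adjoint_dim)
  have "mat_adjoint (U * A) * (U * A) = mat_adjoint A * (mat_adjoint U * (U * A))"
    unfolding mat_adjoint_mult[OF assms(1,3)] using assms U' A' by (intro assoc_mult_mat) auto
  also have "mat_adjoint U * (U * A) = mat_adjoint U * U * A"
    using assms U' by (intro assoc_mult_mat[symmetric]) auto
  also have "\<dots> = A" using assms by simp
  finally have "mat_adjoint (U * A) * (U * A) = mat_adjoint A * A" .
  then have "complex_of_real (frob (U * A)) = complex_of_real (frob A)"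
    using assms by (simp add: frob_eq_trace[of "U * A" k m] frob_eq_trace[of A n m])
  then show ?thesis using of_real_eq_iff by blast
qed

lemma frob_mult_isometry:
  assumes "A \<in> carrier_mat m n" "U \<in> carrier_mat n n" "U * mat_adjoint U = 1\<^sub>m n"
  shows "frob (A * U) = frob A"
proof -
  have "frob (A * U) = frob (mat_adjoint U * mat_adjoint A)"
    using assms by (simp add: frob_mat_adjoint[of "A * U" m n, symmetric] mat_adjoint_mult)
  also have "\<dots> = frob (mat_adjoint A)"
    using assms by (intro frob_isometry_mult[of _ n n _ m]) (auto simp: mat_adjoint_dim mat_adjoint_adjoint)
  also have "\<dots> = frob A" using assms(1) by (rule frob_mat_adjoint)
  finally show ?thesis .
qed

text \<open>Since \<open>frob\<close> is a squared norm, the triangle inequality takes the form (a +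
  b)^2 \<le> 2 a^2 + 2 b^2.\<close>

lemma frob_minus_le:
  assumes "A \<in> carrier_mat n m" "B \<in> carrier_mat n m" "C \<in> carrier_mat n m"
  shows "frob (A - C) \<le> 2 * frob (A - B) + 2 * frob (B - C)"
proof -
  have *: "(cmod (x - z))\<^sup>2 \<le> 2 * (cmod (x - y))\<^sup>2 + 2 * (cmod (y - z))\<^sup>2" for x y z :: complex
  proof -
    have "cmod (x - z) \<le> cmod (x - y) + cmod (y - z)"
      using norm_triangle_ineq[of "x - y" "y - z"] by simp
    then have "(cmod (x - z))\<^sup>2 \<le> (cmod (x - y) + cmod (y - z))\<^sup>2" by (intro power_mono) auto
    also have "\<dots> \<le> 2 * (cmod (x - y))\<^sup>2 + 2 * (cmod (y - z))\<^sup>2"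
      using sum_squares_bound[of "cmod (x - y)" "cmod (y - z)"] by (simp add: power2_sum)
    finally show ?thesis .
  qed
  have "frob (A - C) = (\<Sum>i<n. \<Sum>j<m. (cmod (A $$ (i, j) - C $$ (i, j)))\<^sup>2)"
    using assms by (simp add: frob_def)
  also have "\<dots> \<le> (\<Sum>i<n. \<Sum>j<m. 2 * (cmod (A $$ (i, j) - B $$ (i, j)))\<^sup>2 + 2 * (cmod (B $$ (i, j) - C $$ (i, j)))\<^sup>2)"
    by (intro sum_mono *)
  also have "\<dots> = 2 * frob (A - B) + 2 * frob (B - C)"
    using assms by (simp add: frob_def sum.distrib sum_distrib_left)
  finally show ?thesis .
qed

lemma frob_nonneg [simp]: "0 \<le> frob A"
  by (simp add: frob_def sum_nonneg)

lemma frob_eq_0D: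
  assumes "A \<in> carrier_mat n m" "frob A = 0"
  shows "A = 0\<^sub>m n m"
proof (rule eq_matI)
  fix i j assume ij: "i < dim_row (0\<^sub>m n m :: complex mat)" "j < dim_col (0\<^sub>m n m :: complex mat)"
  then show "A $$ (i, j) = 0\<^sub>m n m $$ (i, j)"
    using assms by (auto simp: frob_def sum_nonneg_eq_0_iff sum_nonneg)
qed (use assms in auto)

text \<open>Cauchy-Schwarz for each row of \<open>A\<close> against each column of
  \<open>B\<close>.\<close>

lemma frob_mult_le:
  assumes "A \<in> carrier_mat n m" "B \<in> carrier_mat m l"
  shows "frob (A * B) \<le> frob A * frob B"
proof -
  have *: "(cmod ((A * B) $$ (i, j)))\<^sup>2 \<le> (\<Sum>a<m. (cmod (A $$ (i, a)))\<^sup>2) * (\<Sum>a<m. (cmod (B $$ (a, j)))\<^sup>2)"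
    if "i < n" "j < l" for i j
  proof -
    have "cmod ((A * B) $$ (i, j)) \<le> (\<Sum>a<m. \<bar>cmod (A $$ (i, a))\<bar> * \<bar>cmod (B $$ (a, j))\<bar>)"
      unfolding mult_mat_index_sum[OF assms that]
      using norm_sum[of "\<lambda>a. A $$ (i, a) * B $$ (a, j)" "{..<m}"] by (simp add: norm_mult)
    also have "\<dots> \<le> L2_set (\<lambda>a. cmod (A $$ (i, a))) {..<m} * L2_set (\<lambda>a. cmod (B $$ (a, j))) {..<m}"
      by (rule L2_set_mult_ineq)
    finally have "(cmod ((A * B) $$ (i, j)))\<^sup>2 \<le>
        (L2_set (\<lambda>a. cmod (A $$ (i, a))) {..<m} * L2_set (\<lambda>a. cmod (B $$ (a, j))) {..<m})\<^sup>2"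
      by (intro power_mono) auto
    then show ?thesis by (simp add: power_mult_distrib L2_set_def sum_nonneg)
  qed
  have "frob (A * B) \<le> (\<Sum>i<n. \<Sum>j<l. (\<Sum>a<m. (cmod (A $$ (i, a)))\<^sup>2) * (\<Sum>a<m. (cmod (B $$ (a, j)))\<^sup>2))"
    using assms unfolding frob_def by (auto intro!: sum_mono * simp del: index_mult_mat(1))
  also have "\<dots> = frob A * (\<Sum>j<l. \<Sum>a<m. (cmod (B $$ (a, j)))\<^sup>2)"
    using assms by (simp add: frob_def sum_product)
  also have "(\<Sum>j<l. \<Sum>a<m. (cmod (B $$ (a, j)))\<^sup>2) = frob B"
    using assms by (subst sum.swap) (auto simp: frob_def)
  finally show ?thesis .
qed

text \<open>Entrywise 2|xy| \<le> |x|^2 + |y|^2. This is as good as Cauchy-Schwarz when both factors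
  have the same \<open>frob\<close>, as in the estimate for compressions.\<close>

lemma cmod_trace_mult_le:
  assumes "A \<in> carrier_mat n m" "B \<in> carrier_mat m n"
  shows "2 * cmod (mat_trace (A * B)) \<le> frob A + frob B"
proof -
  have "mat_trace (A * B) = (\<Sum>i<n. \<Sum>a<m. A $$ (i, a) * B $$ (a, i))"
    unfolding mat_trace_def using assms
    by (auto simp: mult_mat_index_sum[OF assms] simp del: index_mult_mat(1) intro!: sum.cong)
  then have "2 * cmod (mat_trace (A * B)) \<le> 2 * (\<Sum>i<n. \<Sum>a<m. cmod (A $$ (i, a) * B $$ (a, i)))"
    by (auto intro!: sum_norm_le norm_sum)
  also have "\<dots> = (\<Sum>i<n. \<Sum>a<m. 2 * (cmod (A $$ (i, a)) * cmod (B $$ (a, i))))"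
    by (simp add: sum_distrib_left norm_mult)
  also have "\<dots> \<le> (\<Sum>i<n. \<Sum>a<m. (cmod (A $$ (i, a)))\<^sup>2 + (cmod (B $$ (a, i)))\<^sup>2)"
    by (intro sum_mono) (metis mult.assoc sum_squares_bound)
  also have "\<dots> = frob A + (\<Sum>i<n. \<Sum>a<m. (cmod (B $$ (a, i)))\<^sup>2)"
    using assms by (simp add: frob_def sum.distrib)
  also have "(\<Sum>i<n. \<Sum>a<m. (cmod (B $$ (a, i)))\<^sup>2) = frob B"
    using assms by (subst sum.swap) (auto simp: frob_def)
  finally show ?thesis .
qed

section \<open>Unitary matrices: traces of compressions, rigidity and pigeonhole\<close>

lemma unitary_groupD:
  assumes "U \<in> carrier (unitary_group n)"
  shows "U \<in> carrier_mat n n" "mat_adjoint U * U = 1\<^sub>m n" "U * mat_adjoint U = 1\<^sub>m n"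
    "mat_adjoint U \<in> carrier_mat n n"
  using assms by (auto simp: unitary_group_def mat_adjoint_dim)

lemma unitary_group_simps [simp]:
  "U \<otimes>\<^bsub>unitary_group n\<^esub> V = U * V" "\<one>\<^bsub>unitary_group n\<^esub> = 1\<^sub>m n"
  by (simp_all add: unitary_group_def)

lemma mat_adjoint_minus:
  fixes A B :: "complex mat"
  assumes "A \<in> carrier_mat n m" "B \<in> carrier_mat n m"
  shows "mat_adjoint (A - B) = mat_adjoint A - mat_adjoint B"
proof (rule eq_matI)
  have *: "dim_row (mat_adjoint B) = m" "dim_col (mat_adjoint B) = n"
    "dim_row (mat_adjoint (A - B)) = m" "dim_col (mat_adjoint (A - B)) = n"
    using carrier_matD[OF mat_adjoint_dim[OF assms(2)]]
      carrier_matD[OF mat_adjoint_dim[OF minus_carrier_mat[OF assms(2), of A]]] by auto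
  then show "dim_row (mat_adjoint (A - B)) = dim_row (mat_adjoint A - mat_adjoint B)"
    "dim_col (mat_adjoint (A - B)) = dim_col (mat_adjoint A - mat_adjoint B)" by auto
  show "mat_adjoint (A - B) $$ (i, j) = (mat_adjoint A - mat_adjoint B) $$ (i, j)"
    if "i < dim_row (mat_adjoint A - mat_adjoint B)" "j < dim_col (mat_adjoint A - mat_adjoint B)" for i j
    using that * carrier_matD[OF assms(1)] carrier_matD[OF assms(2)] by (simp add: mat_adjoint_index)
qed

text \<open>With \<open>Q\<close> the projection onto the complement of the range of
  \<open>W\<close>, the difference of the traces is the trace of \<open>U * Q * Q\<close>. The
  factors \<open>U * Q\<close> and \<open>Q\<close> have the same \<open>frob\<close>, namely the
  trace \<open>k - d\<close> of \<open>Q\<close>.\<close>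

lemma trace_compression:
  assumes W: "W \<in> isometry_mats d k" and U: "U \<in> carrier (unitary_group k)"
  shows "cmod (mat_trace U - mat_trace (mat_adjoint W * U * W)) \<le> real k - real d"
proof -
  have W1: "W \<in> carrier_mat k d" "mat_adjoint W * W = 1\<^sub>m d" "mat_adjoint W \<in> carrier_mat d k"
    using W by (auto simp: isometry_mats_def mat_adjoint_dim)
  note U = unitary_groupD[OF U]
  define P where "P = W * mat_adjoint W"
  define Q where "Q = 1\<^sub>m k - P"
  have P: "P \<in> carrier_mat k k" using W1 by (auto simp: P_def)
  have Q: "Q \<in> carrier_mat k k" using P unfolding Q_def by (rule minus_carrier_mat)
  have P_adj: "mat_adjoint P = P"
    using W1 unfolding P_def by (simp add: mat_adjoint_mult mat_adjoint_adjoint)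
  have "P * P = W * (mat_adjoint W * (W * mat_adjoint W))"
    unfolding P_def using W1 by (intro assoc_mult_mat) auto
  also have "mat_adjoint W * (W * mat_adjoint W) = mat_adjoint W * W * mat_adjoint W"
    using W1 by (intro assoc_mult_mat[symmetric]) auto
  finally have PP: "P * P = P" using W1 by (simp add: P_def)
  have Q_adj: "mat_adjoint Q = Q"
    unfolding Q_def using P by (simp add: mat_adjoint_minus[of _ k k] mat_adjoint_one P_adj)
  have "Q * Q = 1\<^sub>m k * Q - P * Q"
    using minus_mult_distrib_mat[OF one_carrier_mat P Q] by (simp add: Q_def)
  also have "P * Q = P - P * P"
    using mult_minus_distrib_mat[OF P one_carrier_mat P] P by (simp add: Q_def)
  also have "1\<^sub>m k * Q - (P - P * P) = Q"
    using P Q by (intro eq_matI) (auto simp: PP)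
  finally have QQ: "Q * Q = Q" .
  have "complex_of_real (frob Q) = mat_trace Q"
    using Q by (simp add: frob_eq_trace[of _ k k] Q_adj QQ)
  also have "\<dots> = of_nat k - mat_trace P"
    unfolding Q_def using P by (simp add: mat_trace_minus[of _ k])
  also have "mat_trace P = mat_trace (mat_adjoint W * W)"
    unfolding P_def using W1 by (intro mat_trace_comm) auto
  finally have "complex_of_real (frob Q) = complex_of_real (real k - real d)"
    using W1 by simp
  then have frobQ: "frob Q = real k - real d" using of_real_eq_iff by blast
  have "mat_trace (mat_adjoint W * U * W) = mat_trace (mat_adjoint W * (U * W))"
    using W1 U by (subst assoc_mult_mat) auto
  also have "\<dots> = mat_trace (U * W * mat_adjoint W)"
    using W1 U by (intro mat_trace_comm[of _ d k]) auto
  also have "U * W * mat_adjoint W = U * P"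
    unfolding P_def using W1 U by (intro assoc_mult_mat) auto
  finally have "mat_trace U - mat_trace (mat_adjoint W * U * W) = mat_trace (U - U * P)"
    using U P by (subst mat_trace_minus[of _ k]) auto
  also have "U - U * P = U * Q"
    unfolding Q_def using U P by (subst mult_minus_distrib_mat[of _ k k _ k]) auto
  also have "\<dots> = U * Q * Q"
    using U Q by (subst assoc_mult_mat) (auto simp: QQ)
  finally have "2 * cmod (mat_trace U - mat_trace (mat_adjoint W * U * W)) \<le> frob (U * Q) + frob Q"
    using U Q by (simp only:) (rule cmod_trace_mult_le, auto)
  also have "frob (U * Q) = frob Q"
    using U Q by (intro frob_isometry_mult) auto
  finally show ?thesis using frobQ by simp
qed

text \<open>With \<open>D = Y - 1\<close> one has \<open>3 D = - (Y + 2) D\<^sup>2\<close>, so \<open>D\<close> is either zero or not small.\<close>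

lemma unitary_order3_rigid:
  assumes Y: "Y \<in> carrier (unitary_group n)" and Y3: "Y * (Y * Y) = 1\<^sub>m n"
    and small: "frob (Y - 1\<^sub>m n) < 1"
  shows "Y = 1\<^sub>m n"
proof -
  note Y = unitary_groupD[OF Y]
  define D where "D = Y - 1\<^sub>m n"
  have D: "D \<in> carrier_mat n n" by (auto simp: D_def)
  have YD: "Y * D = Y * Y - Y" unfolding D_def using Y by (simp add: mult_minus_distrib_mat[of _ n n _ n])
  have DD: "D * D = Y * D - D"
    using Y D by (subst D_def) (simp add: minus_mult_distrib_mat[of _ n n])
  have YYD: "Y * (Y * D) = 1\<^sub>m n - Y * Y"
    unfolding YD using Y Y3 by (subst mult_minus_distrib_mat[of _ n n _ n]) auto
  have YDD: "Y * (D * D) = Y * (Y * D) - Y * D"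
    unfolding DD using Y D by (subst mult_minus_distrib_mat[of _ n n _ n]) auto
  have DD': "D * D = Y * Y - Y - (Y - 1\<^sub>m n)"
    unfolding DD by (subst YD, simp only: D_def)
  have YDD': "Y * (D * D) = 1\<^sub>m n - Y * Y - (Y * Y - Y)"
    unfolding YDD by (subst YYD, subst YD, rule refl)
  have eq: "3 * D $$ (i, j) = - ((Y * (D * D)) $$ (i, j) + 2 * (D * D) $$ (i, j))"
    if "i < n" "j < n" for i j
  proof -
    have "(Y * (D * D)) $$ (i, j) = (1\<^sub>m n $$ (i, j) - (Y * Y) $$ (i, j)) - ((Y * Y) $$ (i, j) - Y $$ (i, j))"
      unfolding YDD' using that Y by (simp del: index_mult_mat(1) index_one_mat(1))
    moreover have "(D * D) $$ (i, j) = ((Y * Y) $$ (i, j) - Y $$ (i, j)) - (Y $$ (i, j) - 1\<^sub>m n $$ (i, j))"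
      unfolding DD' using that Y by (simp del: index_mult_mat(1) index_one_mat(1))
    moreover have "D $$ (i, j) = Y $$ (i, j) - 1\<^sub>m n $$ (i, j)"
      unfolding D_def using that Y by (simp del: index_one_mat(1))
    ultimately show ?thesis by (simp only:) (simp add: algebra_simps)
  qed
  \<comment> \<open>The weights 3 and 6 add up to 9, the square of the factor in 3 D. After
    summation 9 cancels and \<open>frob D \<le> frob D * frob D\<close> is left.\<close>
  have *: "(cmod (x + 2 * y))\<^sup>2 \<le> 3 * (cmod x)\<^sup>2 + 6 * (cmod y)\<^sup>2" for x y
  proof -
    have "cmod (x + 2 * y) \<le> cmod x + 2 * cmod y"
      using norm_triangle_ineq[of x "2 * y"] by (simp add: norm_mult)
    then have "(cmod (x + 2 * y))\<^sup>2 \<le> (cmod x + 2 * cmod y)\<^sup>2" by (intro power_mono) auto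
    also have "\<dots> \<le> 3 * (cmod x)\<^sup>2 + 6 * (cmod y)\<^sup>2"
      using sum_squares_bound[of "cmod x" "cmod y"] by (simp add: power2_eq_square algebra_simps)
    finally show ?thesis .
  qed
  have **: "9 * (cmod (D $$ (i, j)))\<^sup>2 \<le> 3 * (cmod ((Y * (D * D)) $$ (i, j)))\<^sup>2 + 6 * (cmod ((D * D) $$ (i, j)))\<^sup>2"
    if "i < n" "j < n" for i j
  proof -
    have "9 * (cmod (D $$ (i, j)))\<^sup>2 = (cmod (3 * D $$ (i, j)))\<^sup>2"
      by (simp add: norm_mult power_mult_distrib)
    then show ?thesis unfolding eq[OF that] using * by (simp only: norm_minus_cancel)
  qed
  have "9 * frob D = (\<Sum>i<n. \<Sum>j<n. 9 * (cmod (D $$ (i, j)))\<^sup>2)"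
    using D by (simp add: frob_def sum_distrib_left)
  also have "\<dots> \<le> (\<Sum>i<n. \<Sum>j<n. 3 * (cmod ((Y * (D * D)) $$ (i, j)))\<^sup>2 + 6 * (cmod ((D * D) $$ (i, j)))\<^sup>2)"
    using ** by (intro sum_mono) auto
  also have "\<dots> = 3 * frob (Y * (D * D)) + 6 * frob (D * D)"
    using Y D by (simp add: frob_def sum.distrib sum_distrib_left del: index_mult_mat(1))
  also have "frob (Y * (D * D)) = frob (D * D)"
    using Y D by (intro frob_isometry_mult) auto
  also have "3 * frob (D * D) + 6 * frob (D * D) \<le> 9 * (frob D * frob D)"
    using frob_mult_le[OF D D] by simp
  finally have "frob D \<le> frob D * frob D" by simp
  then have "\<not> frob D > 0" using small unfolding D_def[symmetric] by auto
  then have "frob D = 0" using frob_nonneg[of D] by linarith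
  then have "D = 0\<^sub>m n n" using D frob_eq_0D by blast
  then have "D $$ (i, j) = 0" if "i < n" "j < n" for i j using that by simp
  then show ?thesis unfolding D_def using Y by (intro eq_matI) auto
qed

lemma unitary_cmod_entry_le:
  assumes "U \<in> carrier (unitary_group n)" "i < n" "j < n"
  shows "cmod (U $$ (i, j)) \<le> 1"
proof -
  note U = unitary_groupD[OF assms(1)]
  have "op_norm U \<le> 1"
    using U by (intro op_norm_le) (auto simp: l2_norm_isometry[OF U(1,2)])
  moreover have "cmod (U $$ (i, j)) \<le> op_norm U"
    using U assms by (intro cmod_entry_le_op_norm) auto
  ultimately show ?thesis by linarith
qed

text \<open>Pigeonhole in place of compactness: all entries lie in the unit disc, which finitely
  many square cells of side 1/M cover, so two members of the sequence have every entry in the same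
  cell.\<close>

lemma unitary_sequence_close_pair:
  assumes U: "\<And>i::nat. U i \<in> carrier (unitary_group n)"
  shows "\<exists>i j. i < j \<and> frob (U i - U j) < 1 / 4"
proof -
  \<comment> \<open>The n^2 entries contribute at most 2/M^2 each, and 8 n^2 < M^2 makes the sum
    less than 1/4. The summand 1 keeps \<open>M\<close> positive for \<open>n = 0\<close>.\<close>
  define M where "M = 4 * real (n + 1)"
  have M: "M > 0" by (simp add: M_def)
  define cell where "cell = (\<lambda>z. (\<lfloor>M * Re z\<rfloor>, \<lfloor>M * Im z\<rfloor>))"
  define code where "code i = (\<lambda>p\<in>{..<n} \<times> {..<n}. cell (U i $$ p))" for i
  define B where "B = {- int (4 * (n + 1))..int (4 * (n + 1))}"
  have fl: "\<lfloor>M * x\<rfloor> \<in> B" if "\<bar>x\<bar> \<le> 1" for x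
  proof -
    have "\<bar>M * x\<bar> \<le> M * 1" unfolding abs_mult using M that by (intro mult_mono) auto
    then have "- M \<le> M * x" "M * x \<le> M" by auto
    moreover have "M = of_int (int (4 * (n + 1)))" by (simp add: M_def)
    ultimately have "- int (4 * (n + 1)) \<le> \<lfloor>M * x\<rfloor>" "\<lfloor>M * x\<rfloor> \<le> int (4 * (n + 1))" by linarith+
    then show ?thesis unfolding B_def by simp
  qed
  have cellB: "cell z \<in> B \<times> B" if "cmod z \<le> 1" for z
    unfolding cell_def using that abs_Re_le_cmod[of z] abs_Im_le_cmod[of z] by (auto intro!: fl)
  have "code ` UNIV \<subseteq> ({..<n} \<times> {..<n}) \<rightarrow>\<^sub>E (B \<times> B)"
    unfolding code_def
    using cellB unitary_cmod_entry_le[OF U] by (auto simp only: restrict_PiE_iff image_subset_iff)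
  moreover have "finite (({..<n} \<times> {..<n}) \<rightarrow>\<^sub>E (B \<times> B))"
    by (intro finite_PiE) (auto simp: B_def)
  ultimately have "finite (code ` UNIV)" by (rule finite_subset)
  then obtain i0 where "infinite {i \<in> UNIV. code i = code i0}"
    using pigeonhole_infinite[of UNIV code] infinite_UNIV_nat by auto
  then have inf: "infinite {i. code i = code i0}" by simp
  obtain i where i: "code i = code i0" using inf by blast
  obtain j where j: "code j = code i0" "i < j"
    using inf unfolding infinite_nat_iff_unbounded by auto
  have close: "\<bar>x - y\<bar> \<le> 1 / M" if "\<lfloor>M * x\<rfloor> = \<lfloor>M * y\<rfloor>" for x y
  proof -
    have "\<bar>M * x - M * y\<bar> < 1" using that by linarith
    then have "M * \<bar>x - y\<bar> < 1" using M by (simp add: right_diff_distrib[symmetric] abs_mult)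
    then show ?thesis using M by (simp add: field_simps)
  qed
  have entry: "(cmod (U i $$ (a, b) - U j $$ (a, b)))\<^sup>2 \<le> 2 / M\<^sup>2" if "a < n" "b < n" for a b
  proof -
    have "code i (a, b) = code j (a, b)" using i j by simp
    then have "cell (U i $$ (a, b)) = cell (U j $$ (a, b))" using that by (simp add: code_def)
    then have "\<bar>Re (U i $$ (a, b) - U j $$ (a, b))\<bar> \<le> 1 / M" "\<bar>Im (U i $$ (a, b) - U j $$ (a, b))\<bar> \<le> 1 / M"
      unfolding cell_def by (auto intro: close)
    then have "(Re (U i $$ (a, b) - U j $$ (a, b)))\<^sup>2 \<le> (1 / M)\<^sup>2" "(Im (U i $$ (a, b) - U j $$ (a, b)))\<^sup>2 \<le> (1 / M)\<^sup>2"
      using M by (auto simp: abs_le_square_iff[symmetric])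
    then show ?thesis by (simp add: cmod_power2 power_divide)
  qed
  have "frob (U i - U j) = (\<Sum>a<n. \<Sum>b<n. (cmod (U i $$ (a, b) - U j $$ (a, b)))\<^sup>2)"
    using unitary_groupD(1)[OF U, of i] unitary_groupD(1)[OF U, of j] by (simp add: frob_def)
  also have "\<dots> \<le> (\<Sum>a<n. \<Sum>b<n. 2 / M\<^sup>2)" by (intro sum_mono entry) auto
  also have "\<dots> = 2 * (real n)\<^sup>2 / M\<^sup>2" by (simp add: power2_eq_square)
  also have "\<dots> < 1 / 4"
  proof -
    have "8 * (real n)\<^sup>2 < M\<^sup>2" unfolding M_def by (simp add: power2_eq_square algebra_simps add_pos_nonneg)
    then show ?thesis using M by (simp add: field_simps)
  qed
  finally show ?thesis using j by blast
qed

text \<open>A finite-dimensional representation moves two of the \<open>q i\<close> close together; conjugating by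
  \<open>v i\<close> then shows that \<open>q i\<close> is almost equal to its inverse.\<close>

lemma finite_dim_rep_kills:
  assumes G: "group G" and \<pi>: "\<pi> \<in> hom G (unitary_group n)"
    and q: "\<And>i. q i \<in> carrier G" and v: "\<And>i. v i \<in> carrier G"
    and q3: "\<And>i. q i \<otimes>\<^bsub>G\<^esub> (q i \<otimes>\<^bsub>G\<^esub> q i) = \<one>\<^bsub>G\<^esub>"
    and vq: "\<And>i. v i \<otimes>\<^bsub>G\<^esub> q i = q i \<otimes>\<^bsub>G\<^esub> q i \<otimes>\<^bsub>G\<^esub> v i"
    and comm: "\<And>i j::nat. i < j \<Longrightarrow> v i \<otimes>\<^bsub>G\<^esub> q j = q j \<otimes>\<^bsub>G\<^esub> v i"
  shows "\<exists>i. \<pi> (q i) = 1\<^sub>m n"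
proof -
  interpret group G by (rule G)
  interpret h: group_hom G "unitary_group n" \<pi>
    using \<pi> group_unitary_group by (intro group_hom.intro group_hom_axioms.intro G)
  have U: "\<pi> x \<in> carrier (unitary_group n)" if "x \<in> carrier G" for x
    using that by (rule h.hom_closed)
  have mult: "\<pi> (x \<otimes>\<^bsub>G\<^esub> y) = \<pi> x * \<pi> y" if "x \<in> carrier G" "y \<in> carrier G" for x y
    using h.hom_mult[OF that] by simp
  obtain i j where ij: "i < j" "frob (\<pi> (q i) - \<pi> (q j)) < 1 / 4"
    using unitary_sequence_close_pair[of "\<lambda>i. \<pi> (q i)", OF U[OF q]] by blast
  define Y Z V where "Y = \<pi> (q i)" and "Z = \<pi> (q j)" and "V = \<pi> (v i)"
  have Yu: "Y \<in> carrier (unitary_group n)" and Zu: "Z \<in> carrier (unitary_group n)"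
    and Vu: "V \<in> carrier (unitary_group n)"
    using U q v by (auto simp: Y_def Z_def V_def)
  note Y = unitary_groupD[OF Yu] and Z = unitary_groupD[OF Zu] and V = unitary_groupD[OF Vu]
  have Y3: "Y * (Y * Y) = 1\<^sub>m n"
    using arg_cong[OF q3[of i], of \<pi>] h.hom_one q by (simp add: mult Y_def)
  have VY: "V * Y = Y * Y * V"
    using arg_cong[OF vq[of i], of \<pi>] q v by (simp add: mult Y_def V_def)
  have VZ: "V * Z = Z * V"
    using arg_cong[OF comm[OF ij(1)], of \<pi>] q v by (simp add: mult Z_def V_def)
  \<comment> \<open>Conjugation by \<open>V\<close> fixes \<open>Z\<close>, because
    \<open>i < j\<close>, and sends \<open>Y\<close> to \<open>Y * Y\<close>. It preserves
    distances, so \<open>Z\<close> is as close to \<open>Y * Y\<close> as to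
    \<open>Y\<close>.\<close>
  have "V * (Y - Z) = (Y * Y - Z) * V"
    using mult_minus_distrib_mat[OF V(1) Y(1) Z(1)] minus_mult_distrib_mat[OF _ Z(1) V(1), of "Y * Y"] Y VY VZ
    by auto
  then have "frob (Y - Z) = frob ((Y * Y - Z) * V)"
    using frob_isometry_mult[OF V(1,2) minus_carrier_mat[OF Z(1), of Y]] by simp
  also have "\<dots> = frob (Y * Y - Z)"
    using Y Z V by (intro frob_mult_isometry) auto
  also have "\<dots> = frob (Z - Y * Y)"
    using Y Z by (simp add: frob_def norm_minus_commute del: index_mult_mat(1))
  \<comment> \<open>The distance 1/4 of the pair is multiplied by 2 + 2, which gives exactly the
    threshold 1 of \<open>unitary_order3_rigid\<close>.\<close>
  finally have "frob (Y - Y * Y) \<le> 2 * frob (Y - Z) + 2 * frob (Y - Z)"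
    using frob_minus_le[of Y n n Z "Y * Y"] Y Z by simp
  moreover have "frob (Y - Y * Y) = frob (Y * (Y - 1\<^sub>m n))"
    using Y by (simp add: mult_minus_distrib_mat[of _ n n _ n] frob_def norm_minus_commute del: index_mult_mat(1))
  moreover have "\<dots> = frob (Y - 1\<^sub>m n)"
    using Y by (intro frob_isometry_mult) auto
  ultimately have "frob (Y - 1\<^sub>m n) < 1" using ij by (simp add: Y_def Z_def)
  then have "Y = 1\<^sub>m n" using unitary_order3_rigid Yu Y3 by blast
  then show ?thesis unfolding Y_def by blast
qed

section \<open>Permutation matrices and regular representations\<close>

text \<open>The basis vector with index \<open>j\<close> goes to the one with index
  \<open>\<sigma> j\<close>, so that composition corresponds to the matrix product in the same
  order.\<close>

definition perm_mat :: "nat \<Rightarrow> (nat \<Rightarrow> nat) \<Rightarrow> complex mat" where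
  "perm_mat m \<sigma> = mat m m (\<lambda>(i, j). if i = \<sigma> j then 1 else 0)"

lemma perm_mat_carrier [simp]: "perm_mat m \<sigma> \<in> carrier_mat m m"
  by (simp add: perm_mat_def)

lemma perm_mat_index [simp]:
  "i < m \<Longrightarrow> j < m \<Longrightarrow> perm_mat m \<sigma> $$ (i, j) = (if i = \<sigma> j then 1 else 0)"
  by (simp add: perm_mat_def)

lemma perm_mat_dim [simp]: "dim_row (perm_mat m \<sigma>) = m" "dim_col (perm_mat m \<sigma>) = m"
  by (simp_all add: perm_mat_def)

lemma perm_mat_id [simp]: "perm_mat m id = 1\<^sub>m m"
  by (rule eq_matI) auto

lemma permutes_lessThan:
  fixes \<sigma> :: "nat \<Rightarrow> nat"
  assumes "\<sigma> permutes {..<m}" "i < m"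
  shows "\<sigma> i < m"
  using permutes_in_image[OF assms(1), of i] assms(2) by simp

text \<open>Multiplication from the left permutes rows. Reading the product at row
  \<open>\<sigma> i\<close> avoids the inverse permutation.\<close>

lemma perm_mat_mult_index:
  assumes \<sigma>: "\<sigma> permutes {..<m}" and A: "A \<in> carrier_mat m l" and ij: "i < m" "j < l"
  shows "(perm_mat m \<sigma> * A) $$ (\<sigma> i, j) = A $$ (i, j)"
proof -
  have "(perm_mat m \<sigma> * A) $$ (\<sigma> i, j) = (\<Sum>a<m. perm_mat m \<sigma> $$ (\<sigma> i, a) * A $$ (a, j))"
    using A ij permutes_lessThan[OF \<sigma>] by (intro mult_mat_index_sum) auto
  also have "\<dots> = (\<Sum>a<m. if a = i then A $$ (a, j) else 0)"
    using ij permutes_lessThan[OF \<sigma>] permutes_inj[OF \<sigma>]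
    by (intro sum.cong) (auto simp: inj_eq)
  also have "\<dots> = A $$ (i, j)" using ij by simp
  finally show ?thesis .
qed

lemma perm_mat_comp:
  assumes "\<sigma> permutes {..<m}" "\<tau> permutes {..<m}"
  shows "perm_mat m (\<sigma> \<circ> \<tau>) = perm_mat m \<sigma> * perm_mat m \<tau>"
proof (rule eq_matI)
  fix i j assume "i < dim_row (perm_mat m \<sigma> * perm_mat m \<tau>)" "j < dim_col (perm_mat m \<sigma> * perm_mat m \<tau>)"
  then have ij: "i < m" "j < m" by auto
  define a where "a = inv_into UNIV \<sigma> i"
  have i: "i = \<sigma> a" using permutes_inverses[OF assms(1)] by (simp add: a_def)
  have a: "a < m" using ij permutes_lessThan[OF permutes_inv[OF assms(1)]] by (simp add: a_def)
  have "(perm_mat m \<sigma> * perm_mat m \<tau>) $$ (\<sigma> a, j) = perm_mat m \<tau> $$ (a, j)"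
    using assms a ij by (intro perm_mat_mult_index) auto
  then show "perm_mat m (\<sigma> \<circ> \<tau>) $$ (i, j) = (perm_mat m \<sigma> * perm_mat m \<tau>) $$ (i, j)"
    using ij a permutes_inj[OF assms(1)] unfolding i by (auto simp: inj_eq)
qed auto

lemma perm_mat_unitary:
  assumes "\<sigma> permutes {..<m}"
  shows "perm_mat m \<sigma> \<in> carrier (unitary_group m)"
proof -
  have adj: "mat_adjoint (perm_mat m \<sigma>) = perm_mat m (inv_into UNIV \<sigma>)"
  proof (rule eq_matI)
    show d: "dim_row (mat_adjoint (perm_mat m \<sigma>)) = dim_row (perm_mat m (inv_into UNIV \<sigma>))"
      "dim_col (mat_adjoint (perm_mat m \<sigma>)) = dim_col (perm_mat m (inv_into UNIV \<sigma>))"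
      using mat_adjoint_dim[OF perm_mat_carrier[of m \<sigma>]] by auto
    fix i j assume "i < dim_row (perm_mat m (inv_into UNIV \<sigma>))" "j < dim_col (perm_mat m (inv_into UNIV \<sigma>))"
    then have ij: "i < m" "j < m" by auto
    then show "mat_adjoint (perm_mat m \<sigma>) $$ (i, j) = perm_mat m (inv_into UNIV \<sigma>) $$ (i, j)"
      using permutes_inverses[OF assms] by (auto simp: mat_adjoint_index)
  qed
  show ?thesis
    unfolding unitary_group_def
    using perm_mat_comp[OF assms permutes_inv[OF assms]] perm_mat_comp[OF permutes_inv[OF assms] assms]
      permutes_inv_o[OF assms] by (simp add: adj)
qed

lemma mat_trace_perm_mat_no_fixpoint:
  assumes "\<And>i. i < m \<Longrightarrow> \<sigma> i \<noteq> i"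
  shows "mat_trace (perm_mat m \<sigma>) = 0"
proof -
  have "perm_mat m \<sigma> $$ (i, i) = 0" if "i < m" for i
    using assms[OF that, symmetric] that by simp
  then show ?thesis by (simp add: mat_trace_def)
qed

text \<open>The left regular representation of a finite group, moved to indices below
  \<open>m\<close> by the numbering \<open>b\<close>. Each \<open>\<rho> u\<close> is a total
  function that is the identity from \<open>m\<close> on.\<close>

definition regular_action ::
  "('b, 'c) monoid_scheme \<Rightarrow> nat \<Rightarrow> ('b \<Rightarrow> nat) \<Rightarrow> ('b \<Rightarrow> nat \<Rightarrow> nat) \<Rightarrow> bool" where
  "regular_action Q m b \<rho> \<longleftrightarrow> m > 0 \<and> bij_betw b (carrier Q) {..<m} \<and>
    (\<forall>u\<in>carrier Q. \<rho> u permutes {..<m}) \<and>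
    (\<forall>u\<in>carrier Q. \<forall>v\<in>carrier Q. \<rho> (u \<otimes>\<^bsub>Q\<^esub> v) = \<rho> u \<circ> \<rho> v) \<and>
    (\<forall>u\<in>carrier Q. \<forall>v\<in>carrier Q. \<rho> u (b v) = b (u \<otimes>\<^bsub>Q\<^esub> v)) \<and>
    \<rho> \<one>\<^bsub>Q\<^esub> = id"

lemma regular_action_exists:
  fixes Q :: "('b, 'c) monoid_scheme"
  assumes "group Q" "finite (carrier Q)"
  shows "\<exists>m b \<rho>. regular_action Q m b \<rho>"
proof -
  interpret Q: group Q by fact
  define m where "m = card (carrier Q)"
  have m: "m > 0" using assms(2) Q.one_closed by (auto simp: m_def card_gt_0_iff)
  obtain b where b: "bij_betw b (carrier Q) {..<m}"
    using ex_bij_betw_finite_nat[OF assms(2)] by (auto simp: m_def lessThan_atLeast0)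
  define c where "c = inv_into (carrier Q) b"
  have cb: "c (b v) = v" if "v \<in> carrier Q" for v
    using b that by (auto simp: c_def bij_betw_def)
  have c: "c y \<in> carrier Q" "b (c y) = y" if "y < m" for y
    using b that by (auto simp: c_def bij_betw_def intro: inv_into_into f_inv_into_f)
  have b_lt: "b v < m" if "v \<in> carrier Q" for v using b that by (auto simp: bij_betw_def)
  define \<rho> where "\<rho> u y = (if y < m then b (u \<otimes>\<^bsub>Q\<^esub> c y) else y)" for u y
  have \<rho>b: "\<rho> u (b v) = b (u \<otimes>\<^bsub>Q\<^esub> v)" if "u \<in> carrier Q" "v \<in> carrier Q" for u v
    using that by (simp add: \<rho>_def b_lt cb)
  have mult: "\<rho> (u \<otimes>\<^bsub>Q\<^esub> v) = \<rho> u \<circ> \<rho> v" if "u \<in> carrier Q" "v \<in> carrier Q" for u v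
    using that c by (auto simp: fun_eq_iff \<rho>_def b_lt cb Q.m_assoc)
  have one: "\<rho> \<one>\<^bsub>Q\<^esub> = id"
    using c by (auto simp: fun_eq_iff \<rho>_def)
  have perm: "\<rho> u permutes {..<m}" if u: "u \<in> carrier Q" for u
  proof (rule permutes_altdef[THEN iffD2], intro conjI)
    have "\<rho> u \<circ> \<rho> (inv\<^bsub>Q\<^esub> u) = id" "\<rho> (inv\<^bsub>Q\<^esub> u) \<circ> \<rho> u = id"
      using u one by (simp_all add: mult[symmetric])
    then have inv: "\<rho> u (\<rho> (inv\<^bsub>Q\<^esub> u) y) = y" "\<rho> (inv\<^bsub>Q\<^esub> u) (\<rho> u y) = y" for y
      by (auto simp: fun_eq_iff)
    have "\<rho> w y < m" if "w \<in> carrier Q" "y < m" for w y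
      using that c by (auto simp: \<rho>_def intro!: b_lt)
    then show "bij_betw (\<rho> u) {..<m} {..<m}"
      using u inv by (intro bij_betw_byWitness[where f' = "\<rho> (inv\<^bsub>Q\<^esub> u)"]) auto
    show "{x. \<rho> u x \<noteq> x} \<subseteq> {..<m}" by (auto simp: \<rho>_def)
  qed
  show ?thesis
    unfolding regular_action_def using m b perm mult \<rho>b one by blast
qed

section \<open>Trace obstruction to flexible stability\<close>

text \<open>If finite groups approximate \<open>G\<close> and separate \<open>x\<close> from \<open>y\<close>, then their regular
  representations have trace 0 at \<open>x\<close> but 1 at \<open>y\<close>; flexible perturbations cannot change
  normalised traces.\<close>

lemma not_flexibly_stable_if_traces_agree:
  fixes G :: "('a, 'b) monoid_scheme" and Q :: "nat \<Rightarrow> 'c monoid"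
  assumes G: "group G" and x: "x \<in> carrier G" and y: "y \<in> carrier G"
    and traces: "\<And>k \<pi>. \<pi> \<in> hom G (unitary_group k) \<Longrightarrow> mat_trace (\<pi> x) = mat_trace (\<pi> y)"
    and Q: "\<And>n. group (Q n)" "\<And>n. finite (carrier (Q n))"
    and \<alpha>: "\<And>n. \<alpha> n \<in> carrier G \<rightarrow> carrier (Q n)"
    and \<alpha>_mult: "\<And>g h. g \<in> carrier G \<Longrightarrow> h \<in> carrier G \<Longrightarrow>
      \<forall>\<^sub>F n in sequentially. \<alpha> n (g \<otimes>\<^bsub>G\<^esub> h) = \<alpha> n g \<otimes>\<^bsub>Q n\<^esub> \<alpha> n h"
    and \<alpha>x: "\<forall>\<^sub>F n in sequentially. \<alpha> n x \<noteq> \<one>\<^bsub>Q n\<^esub>"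
    and \<alpha>y: "\<forall>\<^sub>F n in sequentially. \<alpha> n y = \<one>\<^bsub>Q n\<^esub>"
  shows "\<not> flexibly_stable G"
proof
  assume stable: "flexibly_stable G"
  have "\<exists>m b \<rho>. regular_action (Q n) m b \<rho>" for n
    by (rule regular_action_exists[OF Q])
  then obtain d b \<rho> where reg: "\<And>n. regular_action (Q n) (d n) (b n) (\<rho> n)"
    by metis
  have d: "d n > 0" and b: "bij_betw (b n) (carrier (Q n)) {..<d n}"
    and \<rho>: "u \<in> carrier (Q n) \<Longrightarrow> \<rho> n u permutes {..<d n}"
    and \<rho>_mult: "u \<in> carrier (Q n) \<Longrightarrow> v \<in> carrier (Q n) \<Longrightarrow> \<rho> n (u \<otimes>\<^bsub>Q n\<^esub> v) = \<rho> n u \<circ> \<rho> n v"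
    and \<rho>_b: "u \<in> carrier (Q n) \<Longrightarrow> v \<in> carrier (Q n) \<Longrightarrow> \<rho> n u (b n v) = b n (u \<otimes>\<^bsub>Q n\<^esub> v)"
    and \<rho>_one: "\<rho> n \<one>\<^bsub>Q n\<^esub> = id" for n u v
    using reg[of n] unfolding regular_action_def by auto
  define \<phi> where "\<phi> n g = perm_mat (d n) (\<rho> n (\<alpha> n g))" for n g
  have \<alpha>': "\<alpha> n g \<in> carrier (Q n)" if "g \<in> carrier G" for n g using \<alpha>[of n] that by auto
  interpret G: group G by fact
  have "asymptotic_representation G d \<phi>"
    unfolding asymptotic_representation_def
  proof (intro conjI allI ballI d)
    show "\<phi> n \<in> carrier G \<rightarrow> carrier (unitary_group (d n))" for n
      unfolding \<phi>_def by (auto intro!: perm_mat_unitary \<rho> \<alpha>')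
    fix g h assume gh: "g \<in> carrier G" "h \<in> carrier G"
    have "\<forall>\<^sub>F n in sequentially. op_norm (\<phi> n (g \<otimes>\<^bsub>G\<^esub> h) - \<phi> n g * \<phi> n h) = 0"
      using \<alpha>_mult[OF gh]
    proof eventually_elim
      case (elim n)
      then have "\<phi> n (g \<otimes>\<^bsub>G\<^esub> h) = \<phi> n g * \<phi> n h"
        using gh by (simp add: \<phi>_def \<rho>_mult \<alpha>' perm_mat_comp \<rho>)
      moreover have "\<phi> n g * \<phi> n h - \<phi> n g * \<phi> n h = 0\<^sub>m (d n) (d n)"
        by (intro minus_r_inv_mat) (simp add: \<phi>_def mult_carrier_mat[of _ "d n" "d n"])
      ultimately show ?case by simp
    qed
    then show "(\<lambda>n. op_norm (\<phi> n (g \<otimes>\<^bsub>G\<^esub> h) - \<phi> n g * \<phi> n h)) \<longlonglongrightarrow> 0"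
      by (rule tendsto_eventually)
  qed
  then obtain k W \<pi> where comp: "asymptotically_compresses G d \<phi> k W \<pi>"
    and ratio: "(\<lambda>n. real (k n) / real (d n)) \<longlonglongrightarrow> 1"
    using stable unfolding flexibly_stable_def by blast
  have W: "W n \<in> isometry_mats (d n) (k n)" and \<pi>: "\<pi> n \<in> hom G (unitary_group (k n))"
    and lim: "g \<in> carrier G \<Longrightarrow> (\<lambda>n. op_norm (mat_adjoint (W n) * \<pi> n g * W n - \<phi> n g)) \<longlonglongrightarrow> 0"
    for n g using comp unfolding asymptotically_compresses_def by blast+
  \<comment> \<open>Each 1/8 costs at most d/8 in the trace, once for the compression and once for
    the approximation. The traces at \<open>x\<close> and at \<open>y\<close> then move by less than
    d/4, while 0 and d must be brought together.\<close>
  have "\<forall>\<^sub>F n in sequentially. real (k n) / real (d n) < 1 + 1 / 8"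
    by (rule order_tendstoD(2)[OF ratio]) simp
  moreover have "\<forall>\<^sub>F n in sequentially. op_norm (mat_adjoint (W n) * \<pi> n x * W n - \<phi> n x) < 1 / 8"
    by (rule order_tendstoD(2)[OF lim[OF x]]) simp
  moreover have "\<forall>\<^sub>F n in sequentially. op_norm (mat_adjoint (W n) * \<pi> n y * W n - \<phi> n y) < 1 / 8"
    by (rule order_tendstoD(2)[OF lim[OF y]]) simp
  ultimately have "\<forall>\<^sub>F n in sequentially. False"
    using \<alpha>x \<alpha>y
  proof eventually_elim
    case (elim n)
    have dn: "real (d n) > 0" using d by simp
    have near: "cmod (mat_trace (\<pi> n g) - mat_trace (\<phi> n g)) < real (d n) / 4"
      if g: "g \<in> carrier G" and small: "op_norm (mat_adjoint (W n) * \<pi> n g * W n - \<phi> n g) < 1 / 8" for g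
    proof -
      have \<pi>g: "\<pi> n g \<in> carrier (unitary_group (k n))" using \<pi>[of n] g by (auto simp: hom_def)
      have Wn: "W n \<in> carrier_mat (k n) (d n)" using W[of n] by (auto simp: isometry_mats_def)
      have C: "mat_adjoint (W n) * \<pi> n g * W n \<in> carrier_mat (d n) (d n)"
        using Wn mat_adjoint_dim[OF Wn] unitary_groupD(1)[OF \<pi>g] by auto
      have P: "\<phi> n g \<in> carrier_mat (d n) (d n)" by (simp add: \<phi>_def)
      have "cmod (mat_trace (\<pi> n g) - mat_trace (mat_adjoint (W n) * \<pi> n g * W n)) \<le> real (k n) - real (d n)"
        by (rule trace_compression[OF W \<pi>g])
      also have "\<dots> \<le> real (d n) / 8" using elim(1) dn by (simp add: field_simps)
      finally have 1: "cmod (mat_trace (\<pi> n g) - mat_trace (mat_adjoint (W n) * \<pi> n g * W n)) \<le> real (d n) / 8" .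
      have "cmod (mat_trace (mat_adjoint (W n) * \<pi> n g * W n) - mat_trace (\<phi> n g))
          \<le> d n * op_norm (mat_adjoint (W n) * \<pi> n g * W n - \<phi> n g)"
        using cmod_mat_trace_le[OF minus_carrier_mat[OF P]] mat_trace_minus[OF C P] by metis
      also have "\<dots> < d n * (1 / 8)" using dn small by (intro mult_strict_left_mono) auto
      finally show ?thesis
        using 1 norm_triangle_ineq[of "mat_trace (\<pi> n g) - mat_trace (mat_adjoint (W n) * \<pi> n g * W n)"
            "mat_trace (mat_adjoint (W n) * \<pi> n g * W n) - mat_trace (\<phi> n g)"] by simp
    qed
    \<comment> \<open>A group acts freely on itself by translation, so an element other than the
      identity has trace 0 in the regular representation.\<close>
    have "\<rho> n (\<alpha> n x) i \<noteq> i" if i: "i < d n" for i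
    proof
      interpret Qn: group "Q n" by (rule Q)
      assume fixed: "\<rho> n (\<alpha> n x) i = i"
      obtain v where v: "v \<in> carrier (Q n)" "i = b n v" 
        using b[of n] i unfolding bij_betw_def by (metis imageE lessThan_iff)
      have "b n (\<alpha> n x \<otimes>\<^bsub>Q n\<^esub> v) = b n v" using fixed v \<rho>_b \<alpha>'[OF x] by simp
      then have "\<alpha> n x \<otimes>\<^bsub>Q n\<^esub> v = v"
        using b[of n] v \<alpha>'[OF x, of n] by (auto simp: bij_betw_def dest!: inj_onD)
      then show False using elim(4) v \<alpha>'[OF x, of n] by simp
    qed
    then have "mat_trace (\<phi> n x) = 0"
      unfolding \<phi>_def by (rule mat_trace_perm_mat_no_fixpoint)
    moreover have "mat_trace (\<phi> n y) = of_nat (d n)"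
      using elim(5) by (simp add: \<phi>_def \<rho>_one)
    moreover have "mat_trace (\<pi> n x) = mat_trace (\<pi> n y)" by (rule traces[OF \<pi>])
    \<comment> \<open>The common value of the two traces would be within d/4 of both 0 and
      d.\<close>
    ultimately have "cmod (mat_trace (\<pi> n y)) < real (d n) / 4"
      "cmod (of_nat (d n) - mat_trace (\<pi> n y)) < real (d n) / 4"
      using near[OF x elim(2)] near[OF y elim(3)] by (simp_all add: norm_minus_commute)
    then have "cmod (of_nat (d n)) < real (d n) / 2"
      using norm_triangle_ineq[of "mat_trace (\<pi> n y)" "of_nat (d n) - mat_trace (\<pi> n y)"] by simp
    then show False using dn by simp
  qed
  then show False by simp
qed

section \<open>Very-flexible stability from Foelner sets\<close>

text \<open>The index \<open>r\<close> codes the pair \<open>(r div d, r mod d)\<close>. Sums over a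
  basis of a tensor product split in this way into double sums.\<close>

lemma sum_div_mod:
  fixes h :: "nat \<Rightarrow> nat \<Rightarrow> 'a :: comm_monoid_add"
  assumes "d > 0"
  shows "(\<Sum>r<m * d. h (r div d) (r mod d)) = (\<Sum>y<m. \<Sum>l<d. h y l)"
proof -
  have lt: "y * d + l < m * d" if "y < m" "l < d" for y l
  proof -
    have "y * d + l < (y + 1) * d" using that by simp
    also have "\<dots> \<le> m * d" using that by (intro mult_right_mono) auto
    finally show ?thesis .
  qed
  have "(\<Sum>y<m. \<Sum>l<d. h y l) = (\<Sum>(y, l)\<in>{..<m} \<times> {..<d}. h y l)"
    by (rule sum.cartesian_product)
  also have "\<dots> = (\<Sum>r<m * d. h (r div d) (r mod d))"
    using assms
    by (intro sum.reindex_bij_witness[of _ "\<lambda>r. (r div d, r mod d)" "\<lambda>(y, l). y * d + l"])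
      (auto simp: lt less_mult_imp_div_less)
  finally show ?thesis by simp
qed

text \<open>This is \<sigma> tensored with the identity of dimension \<open>d\<close>, acting on
  indices \<open>y * d + l\<close>; it is extended by the identity to a total function.\<close>

definition block_perm :: "nat \<Rightarrow> nat \<Rightarrow> (nat \<Rightarrow> nat) \<Rightarrow> nat \<Rightarrow> nat" where
  "block_perm m d \<sigma> r = (if r < m * d then \<sigma> (r div d) * d + r mod d else r)"

lemma block_perm_lt:
  assumes "\<sigma> permutes {..<m}" "r < m * d"
  shows "block_perm m d \<sigma> r < m * d"
proof -
  have d: "d > 0" using assms(2) by (cases d) auto
  have "\<sigma> (r div d) < m"
    using less_mult_imp_div_less[OF assms(2)] by (rule permutes_lessThan[OF assms(1)])
  then have "(\<sigma> (r div d) + 1) * d \<le> m * d" by (intro mult_right_mono) auto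
  moreover have "\<sigma> (r div d) * d + r mod d < (\<sigma> (r div d) + 1) * d" using d by simp
  ultimately show ?thesis using assms(2) by (simp add: block_perm_def)
qed

lemma block_perm_div_mod:
  assumes "r < m * d"
  shows "block_perm m d \<sigma> r div d = \<sigma> (r div d)" "block_perm m d \<sigma> r mod d = r mod d"
proof -
  have "d > 0" using assms by (cases d) auto
  then show "block_perm m d \<sigma> r div d = \<sigma> (r div d)" "block_perm m d \<sigma> r mod d = r mod d"
    using assms by (simp_all add: block_perm_def)
qed

lemma block_perm_comp:
  assumes "\<tau> permutes {..<m}"
  shows "block_perm m d (\<sigma> \<circ> \<tau>) = block_perm m d \<sigma> \<circ> block_perm m d \<tau>"
proof
  fix r
  show "block_perm m d (\<sigma> \<circ> \<tau>) r = (block_perm m d \<sigma> \<circ> block_perm m d \<tau>) r"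
  proof (cases "r < m * d")
    case True
    have "block_perm m d \<sigma> (block_perm m d \<tau> r)
        = \<sigma> (block_perm m d \<tau> r div d) * d + block_perm m d \<tau> r mod d"
      using block_perm_lt[OF assms True] by (simp only: block_perm_def[of m d \<sigma>] if_True)
    also have "\<dots> = \<sigma> (\<tau> (r div d)) * d + r mod d"
      by (simp only: block_perm_div_mod[OF True])
    finally show ?thesis using True by (simp add: block_perm_def[of m d "\<sigma> \<circ> \<tau>"])
  qed (simp add: block_perm_def)
qed

lemma block_perm_id [simp]: "block_perm m d id = id"
  by (auto simp: block_perm_def)

lemma block_perm_permutes:
  assumes "\<sigma> permutes {..<m}"
  shows "block_perm m d \<sigma> permutes {..<m * d}"
proof (rule permutes_altdef[THEN iffD2], intro conjI)
  note inv = permutes_inv[OF assms]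
  have "block_perm m d \<sigma> \<circ> block_perm m d (inv_into UNIV \<sigma>) = id"
    "block_perm m d (inv_into UNIV \<sigma>) \<circ> block_perm m d \<sigma> = id"
    unfolding block_perm_comp[OF inv, symmetric] block_perm_comp[OF assms, symmetric]
      permutes_inv_o[OF assms] by simp_all
  then have "block_perm m d \<sigma> (block_perm m d (inv_into UNIV \<sigma>) r) = r"
    "block_perm m d (inv_into UNIV \<sigma>) (block_perm m d \<sigma> r) = r" for r
    by (auto simp: fun_eq_iff)
  then show "bij_betw (block_perm m d \<sigma>) {..<m * d} {..<m * d}"
    using block_perm_lt[OF assms] block_perm_lt[OF inv]
    by (intro bij_betw_byWitness[where f' = "block_perm m d (inv_into UNIV \<sigma>)"]) auto
  show "{x. block_perm m d \<sigma> x \<noteq> x} \<subseteq> {..<m * d}" by (auto simp: block_perm_def)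
qed

text \<open>The map \<open>v \<mapsto> |F|\<^sup>-\<^sup>1\<^sup>/\<^sup>2 \<Sum>\<^bsub>f \<in> F\<^esub> \<delta>\<^bsub>b f\<^esub> \<otimes> \<phi>(f)\<^sup>* v\<close>, with \<open>\<delta>\<^sub>y \<otimes> e\<^sub>l\<close> at index \<open>y d + l\<close>.\<close>

definition foelner_isometry ::
  "'a set \<Rightarrow> ('a \<Rightarrow> nat) \<Rightarrow> nat \<Rightarrow> nat \<Rightarrow> ('a \<Rightarrow> complex mat) \<Rightarrow> complex mat" where
  "foelner_isometry F b m d \<phi> = mat (m * d) d (\<lambda>(r, j).
    (\<Sum>f\<in>F. if b f = r div d then cnj (\<phi> f $$ (j, r mod d)) else 0) / complex_of_real (sqrt (card F)))"

text \<open>The summand for \<open>f\<close> pairs only with the member f' of \<open>F\<close> that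
  satisfies \<open>b\<close> f' = \<open>\<sigma> (b f)\<close>, if there is one, and contributes
  \<phi>(f') times the adjoint of \<phi>(f). The permutation is arbitrary: the identity gives the
  isometry property, translation by a group element gives the compression.\<close>

lemma foelner_compression_index:
  fixes F :: "'a set"
  assumes F: "finite F" "inj_on b F" "b ` F \<subseteq> {..<m}" and \<sigma>: "\<sigma> permutes {..<m}"
    and \<phi>: "\<And>f. f \<in> F \<Longrightarrow> \<phi> f \<in> carrier_mat d d"
    and ij: "i < d" "j < d"
  defines "W \<equiv> foelner_isometry F b m d \<phi>"
    and "S \<equiv> \<lambda>f. if \<sigma> (b f) \<in> b ` F then \<phi> (the_inv_into F b (\<sigma> (b f))) else 0\<^sub>m d d"
  shows "(mat_adjoint W * perm_mat (m * d) (block_perm m d \<sigma>) * W) $$ (i, j)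
    = (\<Sum>f\<in>F. (S f * mat_adjoint (\<phi> f)) $$ (i, j)) / of_nat (card F)"
proof -
  define P where "P = perm_mat (m * d) (block_perm m d \<sigma>)"
  define w where "w y l j = (\<Sum>f\<in>F. if b f = y then cnj (\<phi> f $$ (j, l)) else 0)" for y l j
  define s where "s = complex_of_real (sqrt (card F))"
  have "s * s = complex_of_real (sqrt (card F) * sqrt (card F))"
    unfolding s_def by (rule of_real_mult[symmetric])
  then have ss: "s * s = of_nat (card F)" "cnj s = s"
    by (simp_all add: s_def)
  have mult_if: "x * (if B then y else 0) = (if B then x * y else 0)" for x y :: complex and B by simp
  have d: "d > 0" using ij by simp
  have W: "W \<in> carrier_mat (m * d) d" by (simp add: W_def foelner_isometry_def)
  note W' = mat_adjoint_dim[OF W]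
  have P: "P \<in> carrier_mat (m * d) (m * d)" by (simp add: P_def)
  have W_index: "W $$ (r, j) = w (r div d) (r mod d) j / s" if "r < m * d" "j < d" for r j
    using that by (simp add: W_def foelner_isometry_def w_def s_def)
  note bp = block_perm_permutes[OF \<sigma>, of d]
  have "(mat_adjoint W * P * W) $$ (i, j) = (mat_adjoint W * (P * W)) $$ (i, j)"
    using assoc_mult_mat[OF W' P W] by simp
  also have "\<dots> = (\<Sum>r<m * d. mat_adjoint W $$ (i, r) * (P * W) $$ (r, j))"
    using W' W P ij by (intro mult_mat_index_sum) auto
  \<comment> \<open>Summing over the permuted rows cancels the permutation matrix against the right
    factor \<open>W\<close>.\<close>
  also have "\<dots> = (\<Sum>r<m * d. mat_adjoint W $$ (i, block_perm m d \<sigma> r) * (P * W) $$ (block_perm m d \<sigma> r, j))"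
    by (subst sum.permute[OF bp]) simp
  also have "\<dots> = (\<Sum>r<m * d. cnj (w (\<sigma> (r div d)) (r mod d) i) * w (r div d) (r mod d) j / of_nat (card F))"
  proof (rule sum.cong[OF refl])
    fix r assume "r \<in> {..<m * d}"
    then have r: "r < m * d" by simp
    note r' = block_perm_lt[OF \<sigma> r]
    have "mat_adjoint W $$ (i, block_perm m d \<sigma> r) = cnj (W $$ (block_perm m d \<sigma> r, i))"
      using W r' ij by (subst mat_adjoint_index) auto
    moreover have "(P * W) $$ (block_perm m d \<sigma> r, j) = W $$ (r, j)"
      unfolding P_def by (rule perm_mat_mult_index[OF bp W r ij(2)])
    ultimately show "mat_adjoint W $$ (i, block_perm m d \<sigma> r) * (P * W) $$ (block_perm m d \<sigma> r, j)
        = cnj (w (\<sigma> (r div d)) (r mod d) i) * w (r div d) (r mod d) j / of_nat (card F)"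
      using r r' ij by (simp add: W_index block_perm_div_mod ss(2) ss(1)[symmetric] del: of_nat_eq_iff)
  qed
  also have "\<dots> = (\<Sum>y<m. \<Sum>l<d. cnj (w (\<sigma> y) l i) * w y l j) / of_nat (card F)"
    using sum_div_mod[OF d, of "\<lambda>y l. cnj (w (\<sigma> y) l i) * w y l j / of_nat (card F)" m]
    by (simp add: sum_divide_distrib)
  also have "(\<Sum>y<m. \<Sum>l<d. cnj (w (\<sigma> y) l i) * w y l j)
      = (\<Sum>l<d. \<Sum>y<m. \<Sum>f\<in>F. if b f = y then cnj (w (\<sigma> y) l i) * cnj (\<phi> f $$ (j, l)) else 0)"
    by (subst sum.swap) (simp only: w_def[of _ _ j] sum_distrib_left mult_if)
  also have "\<dots> = (\<Sum>l<d. \<Sum>f\<in>F. \<Sum>y<m. if b f = y then cnj (w (\<sigma> y) l i) * cnj (\<phi> f $$ (j, l)) else 0)"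
    by (intro sum.cong refl sum.swap)
  also have "\<dots> = (\<Sum>l<d. \<Sum>f\<in>F. cnj (w (\<sigma> (b f)) l i) * cnj (\<phi> f $$ (j, l)))"
    using F by (intro sum.cong refl) auto
  also have "\<dots> = (\<Sum>f\<in>F. \<Sum>l<d. cnj (w (\<sigma> (b f)) l i) * cnj (\<phi> f $$ (j, l)))"
    by (rule sum.swap)
  also have "\<dots> = (\<Sum>f\<in>F. (S f * mat_adjoint (\<phi> f)) $$ (i, j))"
  proof (rule sum.cong[OF refl])
    fix f assume f: "f \<in> F"
    have S: "S f \<in> carrier_mat d d"
      using \<phi> F(2) by (auto simp: S_def the_inv_into_f_f)
    \<comment> \<open>Since \<open>b\<close> is injective on \<open>F\<close>, at most one summand
      of \<open>w (\<sigma> (b f)) l i\<close> is present; with none, \<open>S f\<close> is the zero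
      matrix.\<close>
    have Sw: "cnj (w (\<sigma> (b f)) l i) = S f $$ (i, l)" if l: "l < d" for l
    proof (cases "\<sigma> (b f) \<in> b ` F")
      case True
      then obtain f' where f': "f' \<in> F" "\<sigma> (b f) = b f'" by auto
      have "w (b f') l i = (\<Sum>f\<in>F. if f = f' then cnj (\<phi> f' $$ (i, l)) else 0)"
        unfolding w_def using F(2) f' by (intro sum.cong) (auto dest: inj_onD)
      also have "\<dots> = cnj (\<phi> f' $$ (i, l))" using f' F by simp
      finally show ?thesis using True f' F by (simp add: S_def the_inv_into_f_f)
    next
      case False
      then have "w (\<sigma> (b f)) l i = 0" unfolding w_def by (intro sum.neutral) force
      then show ?thesis using False l ij by (simp add: S_def)
    qed
    have "(S f * mat_adjoint (\<phi> f)) $$ (i, j) = (\<Sum>l<d. S f $$ (i, l) * mat_adjoint (\<phi> f) $$ (l, j))"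
      using S mat_adjoint_dim[OF \<phi>[OF f]] ij by (intro mult_mat_index_sum) auto
    also have "\<dots> = (\<Sum>l<d. cnj (w (\<sigma> (b f)) l i) * cnj (\<phi> f $$ (j, l)))"
      using \<phi>[OF f] ij by (intro sum.cong refl) (auto simp: Sw mat_adjoint_index)
    finally show "(\<Sum>l<d. cnj (w (\<sigma> (b f)) l i) * cnj (\<phi> f $$ (j, l))) = (S f * mat_adjoint (\<phi> f)) $$ (i, j)"
      by simp
  qed
  finally show ?thesis by (simp add: P_def)
qed

text \<open>The representation is the regular representation of \<open>Q\<close> with multiplicity
  \<open>d\<close>. The compression at \<open>g\<close> averages over \<open>F\<close> terms within
  \<delta> of \<phi>(g) when \<open>f\<close> stays in \<open>F\<close>, and terms at distance at
  most 2 for the remaining share \<epsilon>. One choice of \<open>k\<close>, \<open>W\<close>,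
  \<open>\<pi>\<close> serves all \<open>g\<close>, \<open>\<delta>\<close> and
  \<open>\<epsilon>\<close>.\<close>

lemma foelner_dilation:
  fixes G :: "('a, 'b) monoid_scheme" and Q :: "('c, 'e) monoid_scheme"
  assumes G: "group G" and Q: "group Q" "finite (carrier Q)"
    and \<theta>: "\<theta> \<in> hom G Q" "inj_on \<theta> F" and F: "finite F" "F \<noteq> {}" "F \<subseteq> carrier G"
    and \<phi>: "\<phi> \<in> carrier G \<rightarrow> carrier (unitary_group d)"
  shows "\<exists>k W \<pi>. d \<le> k \<and> W \<in> isometry_mats d k \<and> \<pi> \<in> hom G (unitary_group k) \<and>
    (\<forall>g\<in>carrier G. \<forall>\<delta> \<epsilon>. (\<forall>f\<in>F. op_norm (\<phi> (g \<otimes>\<^bsub>G\<^esub> f) - \<phi> g * \<phi> f) \<le> \<delta>) \<longrightarrow>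
      real (card {f\<in>F. g \<otimes>\<^bsub>G\<^esub> f \<notin> F}) \<le> \<epsilon> * real (card F) \<longrightarrow>
      op_norm (mat_adjoint W * \<pi> g * W - \<phi> g) \<le> \<delta> + 2 * \<epsilon>)"
proof -
  interpret group G by fact
  obtain m c \<rho> where reg: "regular_action Q m c \<rho>"
    using regular_action_exists[OF Q] by blast
  have m: "m > 0" and c: "bij_betw c (carrier Q) {..<m}"
    and \<rho>: "u \<in> carrier Q \<Longrightarrow> \<rho> u permutes {..<m}"
    and \<rho>_mult: "u \<in> carrier Q \<Longrightarrow> v \<in> carrier Q \<Longrightarrow> \<rho> (u \<otimes>\<^bsub>Q\<^esub> v) = \<rho> u \<circ> \<rho> v"
    and \<rho>_c: "u \<in> carrier Q \<Longrightarrow> v \<in> carrier Q \<Longrightarrow> \<rho> u (c v) = c (u \<otimes>\<^bsub>Q\<^esub> v)"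
    for u v using reg unfolding regular_action_def by auto
  have \<theta>': "\<theta> g \<in> carrier Q" if "g \<in> carrier G" for g using \<theta> that by (auto simp: hom_def)
  define b where "b f = c (\<theta> f)" for f
  have b_inj: "inj_on b F"
  proof (rule inj_onI)
    fix x y assume "x \<in> F" "y \<in> F" "b x = b y"
    then show "x = y" using c \<theta>' \<theta>(2) F(3) unfolding b_def bij_betw_def by (meson inj_onD subsetD)
  qed
  have b_lt: "b ` F \<subseteq> {..<m}" using c \<theta>' F(3) by (auto simp: b_def bij_betw_def)
  have \<phi>u: "\<phi> g \<in> carrier (unitary_group d)" if "g \<in> carrier G" for g using \<phi> that by auto
  note \<phi>D = unitary_groupD[OF \<phi>u]
  have \<phi>F: "\<phi> f \<in> carrier_mat d d" if "f \<in> F" for f using \<phi>D F(3) that by blast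
  define k where "k = m * d"
  define W where "W = foelner_isometry F b m d \<phi>"
  define \<pi> where "\<pi> g = perm_mat k (block_perm m d (\<rho> (\<theta> g)))" for g
  define S where "S \<sigma> f = (if \<sigma> (b f) \<in> b ` F then \<phi> (the_inv_into F b (\<sigma> (b f))) else 0\<^sub>m d d)" for \<sigma> f
  have W: "W \<in> carrier_mat k d" by (simp add: W_def foelner_isometry_def k_def)
  have W': "mat_adjoint W \<in> carrier_mat d k" using W by (rule mat_adjoint_dim)
  have index: "(mat_adjoint W * perm_mat k (block_perm m d \<sigma>) * W) $$ (i, j)
      = (\<Sum>f\<in>F. (S \<sigma> f * mat_adjoint (\<phi> f)) $$ (i, j)) / of_nat (card F)"
    if "\<sigma> permutes {..<m}" "i < d" "j < d" for \<sigma> i j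
    unfolding W_def S_def k_def
    by (rule foelner_compression_index[OF F(1) b_inj b_lt that(1) \<phi>F that(2,3)])
  have cF: "card F > 0" using F by (simp add: card_gt_0_iff)
  have "mat_adjoint W * W = 1\<^sub>m d"
  proof (rule eq_matI)
    fix i j assume "i < dim_row (1\<^sub>m d :: complex mat)" "j < dim_col (1\<^sub>m d :: complex mat)"
    then have ij: "i < d" "j < d" by auto
    have "mat_adjoint W * W = mat_adjoint W * perm_mat k (block_perm m d id) * W"
      using W' by simp
    also have "\<dots> $$ (i, j) = (\<Sum>f\<in>F. (S id f * mat_adjoint (\<phi> f)) $$ (i, j)) / of_nat (card F)"
      using ij by (intro index permutes_id)
    also have "\<dots> = (\<Sum>f\<in>F. 1\<^sub>m d $$ (i, j)) / of_nat (card F)"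
      using \<phi>D F(3) b_inj
      by (intro arg_cong2[of _ _ _ _ "(/)"] sum.cong refl)
        (auto simp: S_def the_inv_into_f_f subset_iff)
    also have "\<dots> = 1\<^sub>m d $$ (i, j)" using cF by simp
    finally show "(mat_adjoint W * W) $$ (i, j) = 1\<^sub>m d $$ (i, j)" .
  qed (use W W' in auto)
  then have iso: "W \<in> isometry_mats d k" using W by (simp add: isometry_mats_def)
  have \<pi>: "\<pi> \<in> hom G (unitary_group k)"
  proof (rule homI)
    show "\<pi> g \<in> carrier (unitary_group k)" if "g \<in> carrier G" for g
      unfolding \<pi>_def k_def using that by (intro perm_mat_unitary block_perm_permutes \<rho> \<theta>')
    show "\<pi> (g \<otimes>\<^bsub>G\<^esub> h) = \<pi> g \<otimes>\<^bsub>unitary_group k\<^esub> \<pi> h" if "g \<in> carrier G" "h \<in> carrier G" for g h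
      using that hom_mult[OF \<theta>(1) that]
      by (simp add: \<pi>_def k_def \<rho>_mult \<theta>' \<rho> block_perm_comp block_perm_permutes perm_mat_comp)
  qed
  have bound: "op_norm (mat_adjoint W * \<pi> g * W - \<phi> g) \<le> \<delta> + 2 * \<epsilon>"
    if g: "g \<in> carrier G" and \<delta>: "\<forall>f\<in>F. op_norm (\<phi> (g \<otimes>\<^bsub>G\<^esub> f) - \<phi> g * \<phi> f) \<le> \<delta>"
      and \<epsilon>: "real (card {f\<in>F. g \<otimes>\<^bsub>G\<^esub> f \<notin> F}) \<le> \<epsilon> * real (card F)" for g \<delta> \<epsilon>
  proof -
    define T where "T f = S (\<rho> (\<theta> g)) f * mat_adjoint (\<phi> f) - \<phi> g" for f
    have adj: "mat_adjoint (\<phi> f) \<in> carrier_mat d d" if "f \<in> F" for f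
      using mat_adjoint_dim[OF \<phi>F[OF that]] .
    have S_cases: "S \<sigma> f \<in> carrier (unitary_group d) \<or> S \<sigma> f = 0\<^sub>m d d" for \<sigma> f
      using \<phi>u F(3) b_inj by (auto simp: S_def the_inv_into_f_f subset_iff)
    have S_dim: "S \<sigma> f \<in> carrier_mat d d" for \<sigma> f
      using S_cases[of \<sigma> f] by (auto dest: unitary_groupD)
    have T_dim: "T f \<in> carrier_mat d d" if "f \<in> F" for f
      unfolding T_def using \<phi>D(1)[OF g] by (rule minus_carrier_mat)
    have T_le: "op_norm (T f) \<le> (if g \<otimes>\<^bsub>G\<^esub> f \<in> F then \<delta> else 2)" if f: "f \<in> F" for f
    proof (cases "g \<otimes>\<^bsub>G\<^esub> f \<in> F")
      case True
      have fG: "f \<in> carrier G" using f F(3) by blast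
      have "\<rho> (\<theta> g) (b f) = b (g \<otimes>\<^bsub>G\<^esub> f)"
        using g fG hom_mult[OF \<theta>(1) g fG] by (simp add: b_def \<rho>_c \<theta>')
      then have "S (\<rho> (\<theta> g)) f = \<phi> (g \<otimes>\<^bsub>G\<^esub> f)"
        using True b_inj by (simp add: S_def the_inv_into_f_f)
      \<comment> \<open>Inserting the unitary \<phi>(f) and its adjoint exposes the defect of
        multiplicativity as a factor of \<open>T f\<close>.\<close>
      moreover have "\<phi> g = \<phi> g * \<phi> f * mat_adjoint (\<phi> f)"
        using assoc_mult_mat[OF \<phi>D(1)[OF g] \<phi>F[OF f] adj[OF f]] \<phi>D(1)[OF g] \<phi>D(3)[OF fG] by simp
      ultimately have "T f = (\<phi> (g \<otimes>\<^bsub>G\<^esub> f) - \<phi> g * \<phi> f) * mat_adjoint (\<phi> f)"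
        unfolding T_def using \<phi>D(1)[OF g] \<phi>F[OF f] adj[OF f] \<phi>F[OF True]
        by (subst minus_mult_distrib_mat[of _ d d _ _ d]) auto
      moreover have "op_norm ((\<phi> (g \<otimes>\<^bsub>G\<^esub> f) - \<phi> g * \<phi> f) * mat_adjoint (\<phi> f)) \<le> op_norm (\<phi> (g \<otimes>\<^bsub>G\<^esub> f) - \<phi> g * \<phi> f)"
        using adj[OF f] \<phi>D(1)[OF g] \<phi>F[OF f] \<phi>D(3)[OF fG]
        by (intro op_norm_mult_unitary_le[of _ d d] minus_carrier_mat)
          (auto simp: mat_adjoint_adjoint)
      ultimately show ?thesis using \<delta> f True by auto
    next
      case False
      have "op_norm (T f) \<le> 1 + 1"
        unfolding T_def
      proof (rule op_norm_diff_le)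
        show "S (\<rho> (\<theta> g)) f * mat_adjoint (\<phi> f) \<in> carrier_mat d d" using S_dim adj[OF f] by (rule mult_carrier_mat)
        show "\<phi> g \<in> carrier_mat d d" by (rule \<phi>D(1)[OF g])
        fix v :: "complex vec" assume v: "v \<in> carrier_vec d" "l2_norm v \<le> 1"
        show "l2_norm (\<phi> g *\<^sub>v v) \<le> 1" using l2_norm_isometry[OF \<phi>D(1,2)[OF g] v(1)] v by simp
        have fG: "f \<in> carrier G" using f F(3) by blast
        have av: "l2_norm (mat_adjoint (\<phi> f) *\<^sub>v v) = l2_norm v"
          using \<phi>D(3)[OF fG] adj[OF f] v by (intro l2_norm_isometry) (auto simp: mat_adjoint_adjoint)
        have avd: "mat_adjoint (\<phi> f) *\<^sub>v v \<in> carrier_vec d" using adj[OF f] v by simp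
        have "l2_norm (S (\<rho> (\<theta> g)) f *\<^sub>v (mat_adjoint (\<phi> f) *\<^sub>v v)) \<le> 1"
          using S_cases[of "\<rho> (\<theta> g)" f]
        proof
          assume "S (\<rho> (\<theta> g)) f \<in> carrier (unitary_group d)"
          then show ?thesis using l2_norm_isometry[OF unitary_groupD(1,2) avd] av v by simp
        next
          assume "S (\<rho> (\<theta> g)) f = 0\<^sub>m d d"
          then show ?thesis using avd by (simp add: l2_norm_def L2_set_def)
        qed
        then show "l2_norm (S (\<rho> (\<theta> g)) f * mat_adjoint (\<phi> f) *\<^sub>v v) \<le> 1"
          using assoc_mult_mat_vec[OF S_dim adj[OF f] v(1)] by simp
      qed
      then show ?thesis using False by simp
    qed
    have \<delta>0: "\<delta> \<ge> 0" using \<delta> F(2) op_norm_nonneg by (meson ex_in_conv order_trans)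
    have "op_norm (mat_adjoint W * \<pi> g * W - \<phi> g) \<le> (\<Sum>f\<in>F. op_norm (T f)) / card F"
    proof (rule op_norm_average_le[OF F(1,2) _ T_dim])
      have "mat_adjoint W * \<pi> g * W \<in> carrier_mat d d"
        using W W' by (auto simp: \<pi>_def)
      then show "mat_adjoint W * \<pi> g * W - \<phi> g \<in> carrier_mat d d"
        using \<phi>D(1)[OF g] by (intro minus_carrier_mat)
      fix i j assume ij: "i < d" "j < d"
      have "(mat_adjoint W * \<pi> g * W - \<phi> g) $$ (i, j) = (mat_adjoint W * \<pi> g * W) $$ (i, j) - \<phi> g $$ (i, j)"
        using ij \<phi>D(1)[OF g] by (simp del: index_mult_mat(1))
      also have "(mat_adjoint W * \<pi> g * W) $$ (i, j)
          = (\<Sum>f\<in>F. (S (\<rho> (\<theta> g)) f * mat_adjoint (\<phi> f)) $$ (i, j)) / of_nat (card F)"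
        unfolding \<pi>_def using ij by (intro index \<rho> \<theta>' g)
      also have "\<dots> - \<phi> g $$ (i, j) = (\<Sum>f\<in>F. (S (\<rho> (\<theta> g)) f * mat_adjoint (\<phi> f)) $$ (i, j) - \<phi> g $$ (i, j)) / of_nat (card F)"
        using cF by (simp add: sum_subtractf diff_divide_distrib)
      also have "\<dots> = (\<Sum>f\<in>F. T f $$ (i, j)) / of_nat (card F)"
        using ij \<phi>D(1)[OF g] by (simp add: T_def del: index_mult_mat(1))
      finally show "(mat_adjoint W * \<pi> g * W - \<phi> g) $$ (i, j) = (\<Sum>f\<in>F. T f $$ (i, j)) / of_nat (card F)" .
    qed
    also have "\<dots> \<le> (\<Sum>f\<in>F. \<delta> + (if g \<otimes>\<^bsub>G\<^esub> f \<notin> F then 2 else 0)) / card F"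
      using \<delta>0 by (intro divide_right_mono sum_mono order_trans[OF T_le]) auto
    also have "(\<Sum>f\<in>F. \<delta> + (if g \<otimes>\<^bsub>G\<^esub> f \<notin> F then 2 else 0)) = card F * \<delta> + 2 * real (card {f\<in>F. g \<otimes>\<^bsub>G\<^esub> f \<notin> F})"
      using F(1) by (simp add: sum.distrib sum.If_cases Int_def conj_commute)
    also have "\<dots> / card F \<le> (card F * \<delta> + 2 * (\<epsilon> * real (card F))) / card F"
      using \<epsilon> by (intro divide_right_mono) auto
    also have "\<dots> = \<delta> + 2 * \<epsilon>" using cF by (simp add: field_simps)
    finally show ?thesis .
  qed
  have "d \<le> k" using m by (simp add: k_def)
  with iso \<pi> bound show ?thesis by blast
qed

text \<open>\<open>M n\<close> is the largest \<open>m \<le> n\<close> whose threshold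
  \<open>N m\<close> has been reached. The element 0 is a default that makes the maximum defined
  before any threshold is reached, hence the conclusion holds only for large
  \<open>n\<close>.\<close>

lemma diagonal_sequence:
  fixes P :: "nat \<Rightarrow> nat \<Rightarrow> bool"
  assumes "\<And>m. eventually (P m) sequentially"
  shows "\<exists>M. filterlim M at_top sequentially \<and> (\<forall>\<^sub>F n in sequentially. P (M n) n)"
proof -
  obtain N where N: "\<And>m n. n \<ge> N m \<Longrightarrow> P m n"
    using assms unfolding eventually_sequentially by metis
  define A where "A n = insert 0 {m. m \<le> n \<and> N m \<le> n}" for n
  define M where "M n = Max (A n)" for n
  have fin: "finite (A n)" for n by (simp add: A_def)
  have "M n \<in> A n" for n unfolding M_def using fin by (intro Max_in) (auto simp: A_def)
  then have "P (M n) n" if "n \<ge> N 0" for n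
    using N that unfolding A_def by (metis (no_types, lifting) insertE mem_Collect_eq)
  moreover have "M n \<ge> m" if "n \<ge> max m (N m)" for m n
    unfolding M_def using fin that by (intro Max_ge) (auto simp: A_def)
  ultimately show ?thesis
    unfolding filterlim_at_top eventually_sequentially by blast
qed

text \<open>Stage \<open>m\<close> takes a Foelner set for the first \<open>m\<close> elements of an
  enumeration with tolerance 1/(m + 1). The stage used for \<phi>_n grows so slowly that \<phi>_n is
  already multiplicative within that tolerance on the pairs that matter.\<close>

lemma very_flexibly_stable_if_foelner:
  fixes G :: "('a, 'b) monoid_scheme"
  assumes G: "group G" "countable (carrier G)"
    and foelner: "\<And>K \<epsilon>. finite K \<Longrightarrow> K \<subseteq> carrier G \<Longrightarrow> \<epsilon> > 0 \<Longrightarrow>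
      \<exists>F (Q :: 'c monoid) \<theta>. finite F \<and> F \<noteq> {} \<and> F \<subseteq> carrier G \<and>
        (\<forall>g\<in>K. real (card {f\<in>F. g \<otimes>\<^bsub>G\<^esub> f \<notin> F}) \<le> \<epsilon> * real (card F)) \<and>
        group Q \<and> finite (carrier Q) \<and> \<theta> \<in> hom G Q \<and> inj_on \<theta> F"
  shows "very_flexibly_stable G"
  unfolding very_flexibly_stable_def
proof (intro allI impI)
  fix d \<phi> assume rep: "asymptotic_representation G d \<phi>"
  interpret group G by fact
  have \<phi>: "\<phi> n \<in> carrier G \<rightarrow> carrier (unitary_group (d n))"
    and lim: "g \<in> carrier G \<Longrightarrow> h \<in> carrier G \<Longrightarrow>
      (\<lambda>n. op_norm (\<phi> n (g \<otimes>\<^bsub>G\<^esub> h) - \<phi> n g * \<phi> n h)) \<longlonglongrightarrow> 0" for n g h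
    using rep unfolding asymptotic_representation_def by auto
  define c where "c = from_nat_into (carrier G)"
  have c: "range c = carrier G"
    unfolding c_def using G(2) one_closed by (intro range_from_nat_into) auto
  define \<epsilon> where "\<epsilon> m = 1 / real (Suc m)" for m
  have \<epsilon>: "\<epsilon> m > 0" for m by (simp add: \<epsilon>_def)
  define good where "good m F \<longleftrightarrow> finite F \<and> F \<noteq> {} \<and> F \<subseteq> carrier G \<and>
    (\<forall>g\<in>c ` {..<m}. real (card {f\<in>F. g \<otimes>\<^bsub>G\<^esub> f \<notin> F}) \<le> \<epsilon> m * real (card F)) \<and>
    (\<exists>(Q :: 'c monoid) \<theta>. group Q \<and> finite (carrier Q) \<and> \<theta> \<in> hom G Q \<and> inj_on \<theta> F)" for m F
  have "\<exists>F. good m F" for m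
  proof -
    have "finite (c ` {..<m})" "c ` {..<m} \<subseteq> carrier G" using c by auto
    from foelner[OF this \<epsilon>[of m]] show ?thesis unfolding good_def by blast
  qed
  then obtain F where F: "\<And>m. good m (F m)" by metis
  have FG: "F m \<subseteq> carrier G" "finite (F m)" for m using F[of m] by (auto simp: good_def)
  define P where "P m n \<longleftrightarrow> (\<forall>g\<in>c ` {..<m}. \<forall>f\<in>F m. op_norm (\<phi> n (g \<otimes>\<^bsub>G\<^esub> f) - \<phi> n g * \<phi> n f) \<le> \<epsilon> m)" for m n
  have "eventually (P m) sequentially" for m
  proof -
    have "\<forall>\<^sub>F n in sequentially. op_norm (\<phi> n (g \<otimes>\<^bsub>G\<^esub> f) - \<phi> n g * \<phi> n f) \<le> \<epsilon> m"
      if "g \<in> c ` {..<m}" "f \<in> F m" for g f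
    proof -
      have "g \<in> carrier G" "f \<in> carrier G" using that c FG by auto
      from order_tendstoD(2)[OF lim[OF this] \<epsilon>[of m]] show ?thesis
        by (rule eventually_mono) simp
    qed
    then show ?thesis unfolding P_def using FG(2) by (simp add: eventually_ball_finite)
  qed
  then obtain M where M: "filterlim M at_top sequentially" "\<forall>\<^sub>F n in sequentially. P (M n) n"
    using diagonal_sequence[of P] by blast
  define compress where "compress n k W \<pi> \<longleftrightarrow> d n \<le> k \<and> W \<in> isometry_mats (d n) k \<and> \<pi> \<in> hom G (unitary_group k) \<and>
    (\<forall>g\<in>carrier G. \<forall>\<delta> \<epsilon>. (\<forall>f\<in>F (M n). op_norm (\<phi> n (g \<otimes>\<^bsub>G\<^esub> f) - \<phi> n g * \<phi> n f) \<le> \<delta>) \<longrightarrow>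
      real (card {f\<in>F (M n). g \<otimes>\<^bsub>G\<^esub> f \<notin> F (M n)}) \<le> \<epsilon> * real (card (F (M n))) \<longrightarrow>
      op_norm (mat_adjoint W * \<pi> g * W - \<phi> n g) \<le> \<delta> + 2 * \<epsilon>)" for n k W \<pi>
  \<comment> \<open>The dilation exists for every \<open>n\<close>; \<open>P (M n) n\<close> enters
    only later, in the estimate for large \<open>n\<close>.\<close>
  have "\<exists>k W \<pi>. compress n k W \<pi>" for n
  proof -
    obtain Q :: "'c monoid" and \<theta> where "group Q" "finite (carrier Q)" "\<theta> \<in> hom G Q" "inj_on \<theta> (F (M n))"
      using F[of "M n"] unfolding good_def by blast
    from foelner_dilation[OF G(1) this _ _ FG(1) \<phi>] show ?thesis
      using F[of "M n"] unfolding good_def compress_def by blast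
  qed
  then obtain k W \<pi> where kW\<pi>: "\<And>n. compress n (k n) (W n) (\<pi> n)" by metis
  have "asymptotically_compresses G d \<phi> k W \<pi>"
    unfolding asymptotically_compresses_def
  proof (intro conjI allI ballI)
    show "d n \<le> k n" "W n \<in> isometry_mats (d n) (k n)" "\<pi> n \<in> hom G (unitary_group (k n))" for n
      using kW\<pi>[of n] unfolding compress_def by auto
    fix g assume g: "g \<in> carrier G"
    then obtain i where i: "g = c i" using c by auto
    have "\<forall>\<^sub>F n in sequentially. Suc i \<le> M n" using M(1) unfolding filterlim_at_top by blast
    with M(2) have bound: "\<forall>\<^sub>F n in sequentially. op_norm (mat_adjoint (W n) * \<pi> n g * W n - \<phi> n g) \<le> 3 * \<epsilon> (M n)"
    proof eventually_elim
      case (elim n)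
      then have gi: "g \<in> c ` {..<M n}" using i by auto
      have "op_norm (mat_adjoint (W n) * \<pi> n g * W n - \<phi> n g) \<le> \<epsilon> (M n) + 2 * \<epsilon> (M n)"
        using kW\<pi>[of n] g gi elim F[of "M n"] unfolding compress_def P_def good_def by blast
      then show ?case by simp
    qed
    have lim0: "(\<lambda>n. 3 * \<epsilon> (M n)) \<longlonglongrightarrow> 0"
    proof -
      have "\<epsilon> \<longlonglongrightarrow> 0" unfolding \<epsilon>_def by (rule LIMSEQ_Suc) (rule lim_1_over_n)
      from filterlim_compose[OF this M(1)] show ?thesis
        by (intro tendsto_mult_right_zero)
    qed
    show "(\<lambda>n. op_norm (mat_adjoint (W n) * \<pi> n g * W n - \<phi> n g)) \<longlonglongrightarrow> 0"
      by (rule tendsto_sandwich[OF _ bound tendsto_const lim0]) simp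
  qed
  then show "\<exists>k W \<pi>. asymptotically_compresses G d \<phi> k W \<pi>" by blast
qed

section \<open>Products of permutation groups\<close>

text \<open>The full product of the symmetric groups of the \<open>S k\<close>. Taking some
  \<open>S k\<close> empty makes these factors trivial, so finite quotients are formed within the
  same type.\<close>

definition perm_prod :: "(nat \<Rightarrow> 'a set) \<Rightarrow> (nat \<Rightarrow> 'a \<Rightarrow> 'a) monoid" where
  "perm_prod S = \<lparr>carrier = {g. \<forall>k. g k permutes S k}, monoid.mult = \<lambda>g h k. g k \<circ> h k, one = \<lambda>k. id\<rparr>"

lemma perm_prod_simps [simp]:
  "g \<in> carrier (perm_prod S) \<longleftrightarrow> (\<forall>k. g k permutes S k)"
  "g \<otimes>\<^bsub>perm_prod S\<^esub> h = (\<lambda>k. g k \<circ> h k)"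
  "\<one>\<^bsub>perm_prod S\<^esub> = (\<lambda>k. id)"
  by (simp_all add: perm_prod_def)

lemma group_perm_prod: "group (perm_prod S)"
proof (rule groupI)
  fix g assume g: "g \<in> carrier (perm_prod S)"
  then show "\<exists>h\<in>carrier (perm_prod S). h \<otimes>\<^bsub>perm_prod S\<^esub> g = \<one>\<^bsub>perm_prod S\<^esub>"
    by (intro bexI[of _ "\<lambda>k. inv_into UNIV (g k)"]) (auto simp: fun_eq_iff permutes_inv intro: permutes_inverses(2))
qed (auto simp: permutes_compose o_assoc)

lemma finite_perm_prod:
  assumes "\<And>k. finite (S k)" "\<And>k. k > K \<Longrightarrow> S k = {}"
  shows "finite (carrier (perm_prod S))"
proof -
  define R where "R = (\<Pi>\<^sub>E k\<in>{..K}. {p. p permutes S k})"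
  have "carrier (perm_prod S) \<subseteq> (\<lambda>f k. if k \<le> K then f k else id) ` R"
  proof
    fix g assume g: "g \<in> carrier (perm_prod S)"
    have "g k = id" if "k > K" for k
      using g assms(2)[OF that] by (metis perm_prod_simps(1) permutes_empty)
    then have "g = (\<lambda>f k. if k \<le> K then f k else id) (restrict g {..K})"
      by (auto simp: fun_eq_iff)
    moreover have "restrict g {..K} \<in> R" using g by (auto simp: R_def)
    ultimately show "g \<in> (\<lambda>f k. if k \<le> K then f k else id) ` R" by blast
  qed
  moreover have "finite R"
    unfolding R_def using assms(1) by (intro finite_PiE finite_permutations) auto
  ultimately show ?thesis using finite_surj by blast
qed

section \<open>Twisted rotations\<close>

type_synonym site = "int \<times> bool"

text \<open>For \<open>k \<le> K\<close> the quotient of \<open>period K\<close> by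
  \<open>period k\<close> is odd, which \<open>rot_flip\<close> needs. The offset 2 makes even the
  smallest window contain 0, 1 and 2.\<close>

definition period :: "nat \<Rightarrow> int" where
  "period k = 3 ^ (k + 2)"

definition half :: "nat \<Rightarrow> int" where
  "half k = (period k - 1) div 2"

lemma period_eq: "period k = 2 * half k + 1"
proof -
  have "odd (period k)" by (simp add: period_def)
  then show ?thesis unfolding half_def by (elim oddE) simp
qed

lemma period_mult: "k \<le> K \<Longrightarrow> period K = period k * 3 ^ (K - k)"
  unfolding period_def power_add[symmetric] by simp

lemma period_pos [simp]: "0 < period k"
  by (simp add: period_def)

lemma half_Suc: "half (Suc k) = 3 * half k + 1"
  using period_eq[of k] period_eq[of "Suc k"] by (simp add: period_def)

lemma half_0: "half 0 = 4" by (simp add: half_def period_def)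

text \<open>Growth by at least 3 per step leaves room for three fresh sites at distance 3 i for each
  i.\<close>

lemma half_ge: "3 * int k + 4 \<le> half k"
  by (induction k) (simp_all add: half_0 half_Suc)

lemma half_mono: "j \<le> k \<Longrightarrow> half j \<le> half k"
proof (induction rule: dec_induct)
  case (step k)
  then show ?case using half_ge[of k] by (simp add: half_Suc)
qed simp

lemma half_nonneg: "0 \<le> half k" using half_ge[of k] by simp

lemma half_unbounded: "\<exists>K. \<forall>k\<ge>K. c \<le> half k"
proof (intro exI allI impI)
  fix k assume "nat c \<le> k"
  then show "c \<le> half k" using half_ge[of k] by linarith
qed

section \<open>Windows and rotations of the glued cycle\<close>

definition window :: "nat \<Rightarrow> site set" where
  "window k = {- half k..half k} \<times> UNIV"

lemma window_iff [simp]: "(i, b) \<in> window k \<longleftrightarrow> - half k \<le> i \<and> i \<le> half k"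
  by (auto simp: window_def)

lemma window_mem: "w \<in> window k \<longleftrightarrow> - half k \<le> fst w \<and> fst w \<le> half k"
  by (cases w) simp

lemma finite_window [simp]: "finite (window k)"
  by (simp add: window_def)

lemma window_mono: "j \<le> k \<Longrightarrow> window j \<subseteq> window k"
  using half_mono[of j k] by auto

text \<open>\<open>rot e k\<close> translates by \<open>e\<close> along the cycle of length \<open>2 \<cdot> 3\<^sup>k\<^sup>+\<^sup>2\<close> obtained by gluing the two
  copies of \<open>{- half k..half k}\<close> to each other end to end.\<close>

definition rot :: "int \<Rightarrow> nat \<Rightarrow> site \<Rightarrow> site" where
  "rot e k w = (if w \<in> window k
     then ((fst w + e + half k) mod period k - half k, snd w = even ((fst w + e + half k) div period k))
     else w)"

text \<open>The limit of \<open>rot e k\<close> as \<open>k\<close> grows: near a fixed site there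
  is no wrapping, and the copy is kept.\<close>

definition shift :: "int \<Rightarrow> site \<Rightarrow> site" where
  "shift e w = (fst w + e, snd w)"

lemma shift_simp [simp]: "shift e (i, b) = (i + e, b)"
  by (simp add: shift_def)

lemma shift_shift [simp]: "shift (- e) (shift e w) = w" "shift e (shift (- e) w) = w"
  by (simp_all add: shift_def)

lemma rot_in_window: "w \<in> window k \<Longrightarrow> rot e k w \<in> window k"
proof -
  assume w: "w \<in> window k"
  have "0 \<le> (fst w + e + half k) mod period k" "(fst w + e + half k) mod period k < period k"
    by simp_all
  then show ?thesis unfolding rot_def using w period_eq[of k] by (simp add: window_mem)
qed

lemma rot_add: "rot (e + f) k = rot e k \<circ> rot f k"
proof
  fix w
  show "rot (e + f) k w = (rot e k \<circ> rot f k) w"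
  proof (cases "w \<in> window k")
    case True
    define n where "n = period k"
    define x where "x = fst w + f + half k"
    have n: "n > 0" by (simp add: n_def)
    have "x + e = (x mod n + e) + n * (x div n)" using mult_div_mod_eq[of n x] by linarith
    then have "(x + e) div n = x div n + (x mod n + e) div n"
      using n by (metis add.commute div_mult_self2 less_irrefl)
    \<comment> \<open>The numbers of wraps of the two rotations add, so their parities combine;
      equality of booleans is how \<open>rot\<close> records the parity in the second
      component.\<close>
    then have ev: "even ((x + e) div n) \<longleftrightarrow> (even (x div n) \<longleftrightarrow> even ((x mod n + e) div n))"
      by simp
    have f: "rot f k w = (x mod n - half k, snd w = even (x div n))"
      using True by (simp add: rot_def n_def x_def)
    have f': "(x mod n - half k, snd w = even (x div n)) \<in> window k"
      using rot_in_window[OF True, of f] by (simp only: f)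
    have "rot (e + f) k w = ((x + e) mod n - half k, snd w = even ((x + e) div n))"
      using True by (simp add: rot_def n_def x_def ac_simps)
    also have "(x + e) mod n = (x mod n + e) mod n" by (simp add: mod_add_left_eq)
    also have "(snd w = even ((x + e) div n)) = ((snd w = even (x div n)) = even ((x mod n + e) div n))"
      using ev by blast
    also have "((x mod n + e) mod n - half k, (snd w = even (x div n)) = even ((x mod n + e) div n))
        = rot e k (x mod n - half k, snd w = even (x div n))"
      unfolding rot_def[of e] using f' by (simp add: n_def)
    finally show ?thesis by (simp add: f)
  qed (simp add: rot_def)
qed

lemma rot_near:
  assumes "- half k \<le> i" "i \<le> half k" "- half k \<le> i + e" "i + e \<le> half k"
  shows "rot e k (i, b) = (i + e, b)"
proof -
  have "0 \<le> i + e + half k" "i + e + half k < period k"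
    using assms period_eq[of k] by linarith+
  then show ?thesis unfolding rot_def using assms by simp
qed

lemma rot_0: "rot 0 k = id"
proof
  fix w
  show "rot 0 k w = id w"
  proof (cases "w \<in> window k")
    case True
    then show ?thesis by (cases w) (auto simp: rot_near)
  qed (simp add: rot_def)
qed

lemma rot_inverse [simp]: "rot (- e) k (rot e k w) = w" "rot e k (rot (- e) k w) = w"
  by (metis add.left_inverse add.right_inverse comp_apply id_apply rot_0 rot_add)+

lemma rot_permutes: "rot e k permutes window k"
proof (rule permutes_altdef[THEN iffD2], intro conjI)
  show "bij_betw (rot e k) (window k) (window k)"
    by (intro bij_betw_byWitness[where f' = "rot (- e) k"]) (auto simp: rot_in_window simp del: window_iff)
  show "{w. rot e k w \<noteq> w} \<subseteq> window k" by (auto simp: rot_def)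
qed

text \<open>Translation by \<open>period K\<close> passes an odd number 3^(K - k) of copies, so it
  restores the position and exchanges the copies.\<close>

lemma rot_flip:
  assumes "k \<le> K" "w \<in> window k"
  shows "rot (period K) k w = (fst w, \<not> snd w)"
proof -
  define x where "x = fst w + half k"
  have x: "0 \<le> x" "x < period k"
    using assms(2) period_eq[of k] by (simp_all add: x_def window_mem)
  have eq: "fst w + period K + half k = x + 3 ^ (K - k) * period k"
    using period_mult[OF assms(1)] by (simp add: x_def)
  have "(fst w + period K + half k) mod period k = x" "(fst w + period K + half k) div period k = 3 ^ (K - k)"
    unfolding eq using x by simp_all
  then show ?thesis using assms(2) unfolding rot_def by (simp add: x_def)
qed

lemma rot_conj_transpose:
  "rot e k \<circ> Transposition.transpose u v \<circ> rot (- e) k = Transposition.transpose (rot e k u) (rot e k v)"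
proof
  fix w
  have inj: "rot e k x = rot e k y \<longleftrightarrow> x = y" for x y by (metis rot_inverse(1))
  have "w = rot e k (rot (- e) k w)" by simp
  then show "(rot e k \<circ> Transposition.transpose u v \<circ> rot (- e) k) w = Transposition.transpose (rot e k u) (rot e k v) w"
    using inj by (auto simp: Transposition.transpose_def)
qed

text \<open>On \<open>window K\<close> the inverse rotation agrees with the inverse shift; away from
  it \<open>p\<close> is the identity and the conjugating maps cancel. The conjugate therefore does
  not depend on \<open>k\<close> once \<open>k\<close> is large.\<close>

lemma rot_conj_finitary:
  assumes p: "p permutes window K" and k: "half K + \<bar>e\<bar> \<le> half k"
  shows "rot (- e) k \<circ> p \<circ> rot e k = shift (- e) \<circ> p \<circ> shift e"
proof
  fix w
  have near: "rot (- e) k u = shift (- e) u" if "u \<in> window K" for u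
  proof -
    have "- half K \<le> fst u" "fst u \<le> half K" using that by (simp_all add: window_mem)
    then have "- half k \<le> fst u" "fst u \<le> half k" "- half k \<le> fst u + - e" "fst u + - e \<le> half k"
      using k by linarith+
    from rot_near[OF this, of "snd u"] show ?thesis by (simp add: shift_def)
  qed
  have pw: "p u \<in> window K" if "u \<in> window K" for u using permutes_in_image[OF p] that by blast
  show "(rot (- e) k \<circ> p \<circ> rot e k) w = (shift (- e) \<circ> p \<circ> shift e) w"
  proof (cases "rot e k w \<in> window K")
    case True
    then have "shift e w = rot e k w" by (metis near rot_inverse(1) shift_shift(2))
    then show ?thesis using True near[OF pw] by simp
  next
    case False
    have "shift e w \<notin> window K" using False by (metis near rot_inverse(2) shift_shift(1))
    then show ?thesis using False permutes_not_in[OF p] by simp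
  qed
qed

section \<open>The group generated by a rotation and two transpositions\<close>

definition swap :: "bool \<Rightarrow> nat \<Rightarrow> site \<Rightarrow> site" where
  "swap b k = Transposition.transpose (0, b) (1, b)"

abbreviation ambient :: "(nat \<Rightarrow> site \<Rightarrow> site) monoid" where
  "ambient \<equiv> perm_prod window"

definition elements :: "(nat \<Rightarrow> site \<Rightarrow> site) set" where
  "elements = generate ambient {rot 1, swap True, swap False}"

lemma swap_permutes: "swap b k permutes window k"
  unfolding swap_def using half_ge[of k] by (intro permutes_swap_id) auto

lemma generators_subset: "{rot 1, swap True, swap False} \<subseteq> carrier ambient"
  using swap_permutes rot_permutes by auto

lemma subgroup_elements: "subgroup elements ambient"
  unfolding elements_def by (rule group.generate_is_subgroup[OF group_perm_prod generators_subset])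

lemma elements_carrier: "x \<in> elements \<Longrightarrow> x \<in> carrier ambient"
  using subgroup.subset[OF subgroup_elements] by blast

lemma elements_permutes: "x \<in> elements \<Longrightarrow> x k permutes window k"
  using elements_carrier by auto

lemma elements_mult: "x \<in> elements \<Longrightarrow> y \<in> elements \<Longrightarrow> (\<lambda>k. x k \<circ> y k) \<in> elements"
  using subgroup.m_closed[OF subgroup_elements, of x y] by simp

lemma swap_in_elements: "swap b \<in> elements"
  unfolding elements_def by (cases b) (auto intro: generate.incl)

lemma ambient_inv:
  assumes "x \<in> carrier ambient" "y \<in> carrier ambient" "\<And>k. y k \<circ> x k = id"
  shows "inv\<^bsub>ambient\<^esub> x = y"
  using assms by (intro group.inv_equality[OF group_perm_prod]) auto

lemma rot_in_elements: "rot e \<in> elements"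
proof -
  have nat: "rot (int n) \<in> elements" for n
  proof (induction n)
    case 0
    have "rot 0 = (\<lambda>k. id)" by (rule ext) (rule rot_0)
    then show ?case
      using subgroup.one_closed[OF subgroup_elements] by (simp only: perm_prod_simps of_nat_0)
  next
    case (Suc n)
    have "rot 1 \<in> elements" unfolding elements_def by (auto intro: generate.incl)
    note elements_mult[OF this Suc]
    moreover have "(\<lambda>k. rot 1 k \<circ> rot (int n) k) = rot (int (Suc n))"
      by (rule ext) (simp only: rot_add[symmetric] of_nat_Suc)
    ultimately show ?case by simp
  qed
  show ?thesis
  proof (cases e rule: int_cases2)
    case (nonneg n)
    then show ?thesis using nat by simp
  next
    case (nonpos n)
    have "inv\<^bsub>ambient\<^esub> (rot (int n)) = rot e"
      unfolding nonpos
    proof (rule ambient_inv)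
      show "rot (- int n) k \<circ> rot (int n) k = id" for k by (rule ext) simp
    qed (simp_all add: rot_permutes)
    then show ?thesis
      using subgroup.m_inv_closed[OF subgroup_elements nat[of n]] by simp
  qed
qed

section \<open>Normal form of elements on large windows\<close>

text \<open>For large \<open>k\<close> an element acts on \<open>window k\<close> as a fixed finitary permutation preserving the
  two copies, followed by a rotation.\<close>

definition stable_form :: "(nat \<Rightarrow> site \<Rightarrow> site) \<Rightarrow> int \<Rightarrow> (site \<Rightarrow> site) \<Rightarrow> bool" where
  "stable_form x e p \<longleftrightarrow> (\<forall>w. snd (p w) = snd w) \<and> (\<exists>K. p permutes window K \<and> (\<forall>k\<ge>K. x k = rot e k \<circ> p))"

lemma stable_form_snd: "stable_form x e p \<Longrightarrow> snd (p w) = snd w"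
  unfolding stable_form_def by blast

text \<open>Moving \<open>rot f k\<close> to the left past \<open>p\<close> replaces
  \<open>p\<close> by its conjugate, which for large \<open>k\<close> is a conjugate by shifts and
  hence a fixed finitary permutation.\<close>

lemma stable_form_mult:
  assumes x: "stable_form x e p" and y: "stable_form y f q"
  shows "stable_form (\<lambda>k. x k \<circ> y k) (e + f) (shift (- f) \<circ> p \<circ> shift f \<circ> q)"
proof -
  obtain K1 where K1: "p permutes window K1" "\<And>k. k \<ge> K1 \<Longrightarrow> x k = rot e k \<circ> p"
    using x unfolding stable_form_def by blast
  obtain K2 where K2: "q permutes window K2" "\<And>k. k \<ge> K2 \<Longrightarrow> y k = rot f k \<circ> q"
    using y unfolding stable_form_def by blast
  obtain K3 where K3: "\<And>k. k \<ge> K3 \<Longrightarrow> half K1 + \<bar>f\<bar> \<le> half k"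
    using half_unbounded by blast
  define K where "K = max K1 (max K2 K3)"
  have conj: "rot (- f) k \<circ> p \<circ> rot f k = shift (- f) \<circ> p \<circ> shift f" if "k \<ge> K" for k
    using that by (intro rot_conj_finitary[OF K1(1)] K3) (simp add: K_def)
  have "p permutes window K" "q permutes window K"
    by (auto intro!: permutes_subset[OF K1(1)] permutes_subset[OF K2(1)] window_mono simp: K_def
        simp del: window_iff)
  then have "shift (- f) \<circ> p \<circ> shift f \<circ> q permutes window K"
    unfolding conj[OF order_refl, symmetric] by (intro permutes_compose rot_permutes)
  moreover have "x k \<circ> y k = rot (e + f) k \<circ> (shift (- f) \<circ> p \<circ> shift f \<circ> q)" if "k \<ge> K" for k
  proof -
    have "rot (e + f) k \<circ> (shift (- f) \<circ> p \<circ> shift f \<circ> q) = rot e k \<circ> rot f k \<circ> (rot (- f) k \<circ> p \<circ> rot f k \<circ> q)"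
      unfolding conj[OF that] rot_add by simp
    also have "\<dots> = rot e k \<circ> p \<circ> (rot f k \<circ> q)" by (simp add: fun_eq_iff)
    finally show ?thesis using that K1(2)[of k] K2(2)[of k] by (simp add: K_def)
  qed
  moreover have "snd ((shift (- f) \<circ> p \<circ> shift f \<circ> q) w) = snd w" for w
    using stable_form_snd[OF x] stable_form_snd[OF y] by (simp add: shift_def)
  ultimately show ?thesis unfolding stable_form_def by blast
qed

lemma stable_form_limit:
  assumes "stable_form x e p"
  shows "\<exists>K. \<forall>k\<ge>K. x k w = shift e (p w)"
proof -
  obtain K1 where K1: "\<And>k. k \<ge> K1 \<Longrightarrow> x k = rot e k \<circ> p"
    using assms unfolding stable_form_def by blast
  obtain i b where ib: "p w = (i, b)" by (cases "p w")
  obtain K2 where K2: "\<And>k. k \<ge> K2 \<Longrightarrow> \<bar>i\<bar> + \<bar>e\<bar> \<le> half k" using half_unbounded by blast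
  have "x k w = shift e (p w)" if "k \<ge> max K1 K2" for k
  proof -
    have "x k w = rot e k (i, b)" using K1[of k] that ib by simp
    also have "\<dots> = (i + e, b)" using K2[of k] that by (intro rot_near) auto
    finally show ?thesis using ib by simp
  qed
  then show ?thesis by blast
qed

lemma finitary_fixes_far:
  assumes "p permutes window K" "half K < i"
  shows "p (i, b) = (i, b)"
  using assms by (intro permutes_not_in[OF assms(1)]) auto

text \<open>Both forms give the same pointwise limit. A site outside the supports of
  \<open>p\<close> and \<open>q\<close> is only shifted, which identifies the exponents; cancelling
  the shift identifies the permutations.\<close>

lemma stable_form_unique:
  assumes x: "stable_form x e p" and y: "stable_form x f q"
  shows "e = f" "p = q"
proof -
  have eq: "shift e (p w) = shift f (q w)" for w
  proof -
    obtain K1 where "\<forall>k\<ge>K1. x k w = shift e (p w)" using stable_form_limit[OF x] by blast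
    moreover obtain K2 where "\<forall>k\<ge>K2. x k w = shift f (q w)" using stable_form_limit[OF y] by blast
    ultimately show ?thesis by (metis max.cobounded1 max.cobounded2)
  qed
  obtain K1 K2 where "p permutes window K1" "q permutes window K2"
    using x y unfolding stable_form_def by blast
  then show "e = f"
    using eq[of "(max (half K1) (half K2) + 1, True)"] by (simp add: finitary_fixes_far)
  with eq show "p = q" by (metis ext shift_shift(1))
qed

lemma stable_form_rot: "stable_form (rot e) e id"
  by (auto simp: stable_form_def)

lemma stable_form_const:
  assumes "\<And>w. snd (p w) = snd w" "p permutes window K"
  shows "stable_form (\<lambda>k. p) 0 p"
  using assms by (auto simp: stable_form_def rot_0)

lemma stable_form_swap: "stable_form (swap b) 0 (Transposition.transpose (0, b) (1, b))"
proof -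
  have "swap b = (\<lambda>k. Transposition.transpose (0, b) (1, b))" by (simp add: swap_def fun_eq_iff)
  moreover have "snd (Transposition.transpose (0, b) (1, b) w) = snd w" for w :: site
    by (cases w) (simp add: Transposition.transpose_def)
  ultimately show ?thesis
    using swap_permutes[of b 0] by (simp add: stable_form_const)
qed

lemma stable_form_exists:
  assumes "x \<in> elements"
  shows "\<exists>e p. stable_form x e p"
  using assms unfolding elements_def
proof (induction rule: generate.induct)
  case one
  have "stable_form (\<lambda>k. id) 0 id" by (rule stable_form_const[of _ 0]) (auto simp: permutes_id)
  then show ?case unfolding perm_prod_simps by blast
next
  case (incl x)
  then show ?case using stable_form_rot stable_form_swap by blast
next
  case (inv x)
  have "inv\<^bsub>ambient\<^esub> (rot 1) = rot (- 1)"
    by (intro ambient_inv) (auto simp: rot_permutes fun_eq_iff)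
  moreover have "inv\<^bsub>ambient\<^esub> (swap b) = swap b" for b
    by (intro ambient_inv) (auto simp: swap_permutes, auto simp: swap_def)
  ultimately have "inv\<^bsub>ambient\<^esub> x = rot (- 1) \<or> (\<exists>b. inv\<^bsub>ambient\<^esub> x = swap b)"
    using inv by blast
  then show ?case using stable_form_rot stable_form_swap by metis
next
  case (eng x y)
  then obtain e p f q where "stable_form x e p" "stable_form y f q" by blast
  from stable_form_mult[OF this] show ?case unfolding perm_prod_simps by blast
qed

section \<open>The finitely generated group and its countability\<close>

abbreviation twisted_group :: "(nat \<Rightarrow> site \<Rightarrow> site) monoid" where
  "twisted_group \<equiv> ambient\<lparr>carrier := elements\<rparr>"

lemma group_twisted: "group twisted_group"
  by (rule subgroup.subgroup_is_group[OF subgroup_elements group_perm_prod])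

lemma finitely_generated_twisted: "finitely_generated twisted_group"
  unfolding finitely_generated_def
proof (intro exI conjI)
  have sub: "{rot 1, swap True, swap False} \<subseteq> elements"
    by (auto simp: rot_in_elements swap_in_elements)
  then show "{rot 1, swap True, swap False} \<subseteq> carrier twisted_group" by simp
  show "generate twisted_group {rot 1, swap True, swap False} = carrier twisted_group"
    using group.generate_consistent[OF group_perm_prod sub subgroup_elements] by (simp add: elements_def)
qed simp

text \<open>Each element is the value of a finite word in the generators and their inverses.\<close>

lemma (in group) countable_generate:
  assumes "countable S" "S \<subseteq> carrier G"
  shows "countable (generate G S)"
proof -
  define B where "B = S \<union> m_inv G ` S"
  define P where "P l = foldr (\<otimes>) l \<one>" for l
  have B: "B \<subseteq> carrier G" using assms by (auto simp: B_def)
  have P_closed: "P l \<in> carrier G" if "l \<in> lists B" for l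
    using that B by (induction l) (auto simp: P_def)
  have P_append: "P (l @ m) = P l \<otimes> P m" if "l \<in> lists B" "m \<in> lists B" for l m
    using that
  proof (induction l)
    case Nil
    then show ?case using P_closed by (simp add: P_def)
  next
    case (Cons a l)
    then have "P (a # l @ m) = a \<otimes> (P l \<otimes> P m)" by (simp add: P_def)
    also have "\<dots> = a \<otimes> P l \<otimes> P m" using Cons P_closed B by (subst m_assoc) auto
    finally show ?case by (simp add: P_def)
  qed
  have "generate G S \<subseteq> P ` lists B"
  proof
    fix x assume "x \<in> generate G S"
    then show "x \<in> P ` lists B"
    proof (induction rule: generate.induct)
      case one
      show ?case by (intro image_eqI[of _ _ "[]"]) (auto simp: P_def)
    next
      case (incl h)
      then show ?case using assms(2) by (intro image_eqI[of _ _ "[h]"]) (auto simp: P_def B_def)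
    next
      case (inv h)
      then show ?case using assms(2) by (intro image_eqI[of _ _ "[inv h]"]) (auto simp: P_def B_def)
    next
      case (eng h1 h2)
      then obtain l m where lm: "l \<in> lists B" "m \<in> lists B" "h1 = P l" "h2 = P m" by blast
      show ?case
      proof (rule image_eqI)
        show "h1 \<otimes> h2 = P (l @ m)" using lm by (simp add: P_append)
        show "l @ m \<in> lists B" using lm by simp
      qed
    qed
  qed
  moreover have "countable (P ` lists B)"
    using assms(1) by (intro countable_image countable_lists) (simp add: B_def)
  ultimately show ?thesis by (rule countable_subset)
qed

lemma countable_elements: "countable elements"
  unfolding elements_def
  by (rule group.countable_generate[OF group_perm_prod _ generators_subset]) simp

section \<open>Foelner sets and finite quotients\<close>

text \<open>Finite sets closed under products that exhaust the elements of exponent 0, by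
  \<open>eventually_tail_const\<close>. They make the local finiteness of the kernel of the exponent
  concrete.\<close>

definition tail_const :: "nat \<Rightarrow> (nat \<Rightarrow> site \<Rightarrow> site) set" where
  "tail_const K = {g \<in> elements. \<forall>k\<ge>K. g k = g K}"

lemma tail_constD:
  assumes "g \<in> tail_const K"
  shows "g \<in> elements" "k \<ge> K \<Longrightarrow> g k = g K"
  using assms unfolding tail_const_def by blast+

lemma finite_tail_const: "finite (tail_const K)"
proof -
  define R where "R = (\<Pi>\<^sub>E k\<in>{..K}. {p. p permutes window k})"
  have "tail_const K \<subseteq> (\<lambda>f k. f (min k K)) ` R"
  proof
    fix g assume g: "g \<in> tail_const K"
    have "g k = restrict g {..K} (min k K)" for k
      using tail_constD(2)[OF g, of k] by (cases "k \<le> K") simp_all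
    then have "g = (\<lambda>k. restrict g {..K} (min k K))" by (rule ext)
    moreover have "restrict g {..K} \<in> R"
      using elements_permutes[OF tail_constD(1)[OF g]] by (auto simp: R_def)
    ultimately show "g \<in> (\<lambda>f k. f (min k K)) ` R" by (rule image_eqI)
  qed
  moreover have "finite R"
    unfolding R_def by (intro finite_PiE finite_permutations) auto
  ultimately show ?thesis using finite_surj by blast
qed

lemma id_in_tail_const: "(\<lambda>k. id) \<in> tail_const K"
  using subgroup.one_closed[OF subgroup_elements] by (simp only: tail_const_def perm_prod_simps) simp

lemma tail_const_mult:
  assumes g: "g \<in> tail_const K" and h: "h \<in> tail_const K"
  shows "(\<lambda>k. g k \<circ> h k) \<in> tail_const K"
  unfolding tail_const_def[of K]
proof (intro CollectI conjI allI impI)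
  show "(\<lambda>k. g k \<circ> h k) \<in> elements"
    using tail_constD(1)[OF g] tail_constD(1)[OF h] by (rule elements_mult)
  show "g k \<circ> h k = g K \<circ> h K" if "K \<le> k" for k
    using tail_constD(2)[OF g that] tail_constD(2)[OF h that] by (rule arg_cong2)
qed

text \<open>A site beyond \<open>window K\<close> is fixed by \<open>h K\<close>, hence by all later
  \<open>h k\<close>, whereas in the limit it would move by the exponent.\<close>

lemma stable_form_tail_const:
  assumes "h \<in> tail_const K"
  shows "\<exists>p. stable_form h 0 p"
proof -
  note h = tail_constD[OF assms]
  obtain e p where ep: "stable_form h e p" using stable_form_exists[OF h(1)] by blast
  then obtain K1 where K1: "p permutes window K1" unfolding stable_form_def by blast
  define i where "i = max (half K) (half K1) + 1"
  obtain K2 where K2: "\<And>k. k \<ge> K2 \<Longrightarrow> h k (i, True) = shift e (p (i, True))"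
    using stable_form_limit[OF ep] by blast
  have "h K (i, True) = (i, True)"
    by (rule finitary_fixes_far[OF elements_permutes[OF h(1)]]) (simp add: i_def)
  moreover have "p (i, True) = (i, True)"
    by (rule finitary_fixes_far[OF K1]) (simp add: i_def)
  ultimately have "e = 0" using K2[of "max K K2"] h(2)[of "max K K2"] by simp
  then show ?thesis using ep by blast
qed

lemma eventually_tail_const:
  assumes "x \<in> elements" "stable_form x 0 p"
  shows "\<forall>\<^sub>F K in sequentially. x \<in> tail_const K"
proof -
  obtain K0 where "\<And>k. k \<ge> K0 \<Longrightarrow> x k = p"
    using assms(2) unfolding stable_form_def by (auto simp: rot_0)
  then have "x \<in> tail_const K" if "K \<ge> K0" for K
    using that assms(1) by (simp add: tail_const_def)
  then show ?thesis unfolding eventually_sequentially by blast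
qed

lemma card_leaving_interval:
  "card {i. i < M \<and> \<not> (0 \<le> e + int i \<and> e + int i < int M)} \<le> nat \<bar>e\<bar>"
proof (cases "e \<ge> 0")
  case True
  have "{i. i < M \<and> \<not> (0 \<le> e + int i \<and> e + int i < int M)} \<subseteq> {M - nat e..<M}"
    using True by auto
  then have "card {i. i < M \<and> \<not> (0 \<le> e + int i \<and> e + int i < int M)} \<le> card {M - nat e..<M}"
    by (intro card_mono) auto
  then show ?thesis using True by simp
next
  case False
  have "{i. i < M \<and> \<not> (0 \<le> e + int i \<and> e + int i < int M)} \<subseteq> {..<nat (- e)}"
    using False by auto
  then have "card {i. i < M \<and> \<not> (0 \<le> e + int i \<and> e + int i < int M)} \<le> card {..<nat (- e)}"
    by (intro card_mono) auto
  then show ?thesis using False by simp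
qed

text \<open>The set consists of the products of \<open>rot i\<close> with \<open>h\<close>, for
  \<open>i < M\<close> and \<open>h\<close> in \<open>tail_const L\<close>. Left multiplication by
  \<open>x\<close> changes \<open>i\<close> by the exponent of \<open>x\<close> and multiplies
  \<open>h\<close> by \<open>y x i\<close>. As \<open>L\<close> is chosen after \<open>M\<close> to
  contain all these cocycle values, products leave the set only at the ends of the interval.\<close>

lemma foelner_sets:
  assumes K: "finite K" "K \<subseteq> elements" and \<epsilon>: "(\<epsilon>::real) > 0"
  shows "\<exists>F. finite F \<and> F \<noteq> {} \<and> F \<subseteq> elements \<and>
    (\<forall>g\<in>K. real (card {f\<in>F. (\<lambda>k. g k \<circ> f k) \<notin> F}) \<le> \<epsilon> * real (card F))"
proof -
  have "\<forall>x\<in>K. \<exists>e. \<exists>p. stable_form x e p" using stable_form_exists K(2) by blast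
  then obtain e where e: "\<And>x. x \<in> K \<Longrightarrow> \<exists>p. stable_form x (e x) p" by metis
  \<comment> \<open>The sum of all exponents bounds each one, so a single \<open>M\<close> makes the
    boundary share at most \<epsilon> for every member of \<open>K\<close>.\<close>
  obtain M where "real M > (\<Sum>x\<in>K. real_of_int \<bar>e x\<bar>) / \<epsilon>" using reals_Archimedean2 by blast
  then have M: "(\<Sum>x\<in>K. real_of_int \<bar>e x\<bar>) < \<epsilon> * real M" using \<epsilon> by (simp add: field_simps)
  have "0 \<le> (\<Sum>x\<in>K. real_of_int \<bar>e x\<bar>)" by (intro sum_nonneg) simp
  then have "0 < \<epsilon> * real M" using M by linarith
  then have M_pos: "M > 0" using \<epsilon> by (simp add: zero_less_mult_iff)
  have eM: "real_of_int \<bar>e x\<bar> \<le> \<epsilon> * real M" if "x \<in> K" for x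
    using M member_le_sum[OF that, of "\<lambda>x. real_of_int \<bar>e x\<bar>"] K(1) by simp
  define y where "y x i k = rot (- (e x + int i)) k \<circ> (x k \<circ> rot (int i) k)" for x i k
  have y: "\<forall>\<^sub>F L in sequentially. y x i \<in> tail_const L" if x: "x \<in> K" for x i
  proof -
    obtain p where "stable_form x (e x) p" using e[OF x] by blast
    from stable_form_mult[OF stable_form_rot[of "- (e x + int i)"] stable_form_mult[OF this stable_form_rot[of "int i"]]]
    obtain q where "stable_form (y x i) 0 q" by (auto simp: y_def[abs_def])
    moreover have "y x i \<in> elements"
      unfolding y_def[abs_def] using x K(2) by (intro elements_mult rot_in_elements) auto
    ultimately show ?thesis by (intro eventually_tail_const)
  qed
  have "\<forall>\<^sub>F L in sequentially. \<forall>x\<in>K. \<forall>i\<in>{..<M}. y x i \<in> tail_const L"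
    using K(1) y by (simp add: eventually_ball_finite)
  then obtain L where L: "\<And>x i. x \<in> K \<Longrightarrow> i < M \<Longrightarrow> y x i \<in> tail_const L"
    unfolding eventually_sequentially by auto
  define T where "T = tail_const L"
  have T: "finite T" "T \<noteq> {}" "T \<subseteq> elements"
    unfolding T_def using finite_tail_const id_in_tail_const tail_constD(1) by blast+
  define c :: "nat \<times> (nat \<Rightarrow> site \<Rightarrow> site) \<Rightarrow> nat \<Rightarrow> site \<Rightarrow> site"
    where "c = (\<lambda>(i, h) k. rot (int i) k \<circ> h k)"
  \<comment> \<open>The exponent of the product recovers \<open>i\<close>; cancelling the rotation
    then recovers \<open>h\<close>.\<close>
  have c_inj: "inj_on c ({..<M} \<times> T)"
  proof (rule inj_onI, clarify)
    fix i h j g assume hg: "h \<in> T" "g \<in> T" and eq: "c (i, h) = c (j, g)"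
    obtain p where p: "stable_form h 0 p" using stable_form_tail_const hg(1) unfolding T_def by blast
    obtain q where q: "stable_form g 0 q" using stable_form_tail_const hg(2) unfolding T_def by blast
    have "int i + 0 = int j + 0"
      using stable_form_unique(1)[OF stable_form_mult[OF stable_form_rot p]] stable_form_mult[OF stable_form_rot q]
        eq unfolding c_def split by (metis (no_types))
    then have ij: "i = j" by simp
    have "h k w = g k w" for k w
    proof -
      have "rot (int i) k (h k w) = rot (int i) k (g k w)"
        using fun_cong[OF fun_cong[OF eq, of k], of w] unfolding c_def ij by simp
      then show ?thesis by (metis rot_inverse(1))
    qed
    then show "i = j \<and> h = g" using ij by (auto simp: fun_eq_iff)
  qed
  define F where "F = c ` ({..<M} \<times> T)"
  have card_F: "card F = M * card T"
    unfolding F_def by (simp add: card_image[OF c_inj] card_cartesian_product)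
  have bound: "real (card {f\<in>F. (\<lambda>k. x k \<circ> f k) \<notin> F}) \<le> \<epsilon> * real (card F)" if x: "x \<in> K" for x
  proof -
    define I where "I = {i. i < M \<and> \<not> (0 \<le> e x + int i \<and> e x + int i < int M)}"
    have "{f\<in>F. (\<lambda>k. x k \<circ> f k) \<notin> F} \<subseteq> c ` (I \<times> T)"
    proof
      fix f assume f: "f \<in> {f\<in>F. (\<lambda>k. x k \<circ> f k) \<notin> F}"
      then obtain i h where ih: "i < M" "h \<in> T" "f = c (i, h)" by (auto simp: F_def)
      have "\<not> (0 \<le> e x + int i \<and> e x + int i < int M)"
      proof
        assume in_M: "0 \<le> e x + int i \<and> e x + int i < int M"
        have "(\<lambda>k. x k \<circ> f k) = c (nat (e x + int i), (\<lambda>k. y x i k \<circ> h k))"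
          using in_M by (simp add: c_def ih(3) y_def fun_eq_iff del: minus_add_distrib)
        moreover have "(\<lambda>k. y x i k \<circ> h k) \<in> T"
          using tail_const_mult L[OF x ih(1)] ih(2) unfolding T_def by blast
        moreover have "nat (e x + int i) < M" using in_M by auto
        ultimately have "(\<lambda>k. x k \<circ> f k) \<in> F" unfolding F_def by blast
        then show False using f by simp
      qed
      then show "f \<in> c ` (I \<times> T)" using ih by (auto simp: I_def)
    qed
    then have "card {f\<in>F. (\<lambda>k. x k \<circ> f k) \<notin> F} \<le> card (c ` (I \<times> T))"
      using T(1) by (intro card_mono finite_imageI finite_cartesian_product) (auto simp: I_def)
    also have "\<dots> \<le> card I * card T"
      using T(1) card_image_le[of "I \<times> T" c] by (simp add: card_cartesian_product I_def)
    also have "\<dots> \<le> nat \<bar>e x\<bar> * card T"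
      unfolding I_def by (intro mult_right_mono card_leaving_interval) simp
    finally have "real (card {f\<in>F. (\<lambda>k. x k \<circ> f k) \<notin> F}) \<le> real (nat \<bar>e x\<bar> * card T)"
      by (simp only: of_nat_le_iff)
    also have "\<dots> = real_of_int \<bar>e x\<bar> * real (card T)" by simp
    also have "\<dots> \<le> \<epsilon> * real M * real (card T)" using eM[OF x] by (intro mult_right_mono) auto
    finally show ?thesis by (simp add: card_F)
  qed
  have "finite F" "F \<noteq> {}" using T M_pos by (auto simp: F_def)
  moreover have "F \<subseteq> elements"
    unfolding F_def c_def using T(3) by (auto intro!: elements_mult rot_in_elements)
  ultimately show ?thesis using bound by blast
qed

section \<open>Residual finiteness by truncation\<close>

definition truncate_seq :: "nat \<Rightarrow> (nat \<Rightarrow> 'a \<Rightarrow> 'a) \<Rightarrow> nat \<Rightarrow> 'a \<Rightarrow> 'a" where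
  "truncate_seq K g k = (if k \<le> K then g k else id)"

text \<open>Distinct families differ at some coordinate, and only finitely many pairs have to be
  told apart.\<close>

lemma truncate_seq_separates:
  assumes "finite F"
  shows "\<exists>K. inj_on (truncate_seq K) F"
proof -
  have "\<forall>\<^sub>F K in sequentially. g \<noteq> h \<longrightarrow> truncate_seq K g \<noteq> truncate_seq K h" for g h :: "nat \<Rightarrow> 'a \<Rightarrow> 'a"
  proof (cases "g = h")
    case False
    then obtain k where k: "g k \<noteq> h k" by auto
    have "truncate_seq K g \<noteq> truncate_seq K h" if "K \<ge> k" for K
      using k that by (metis truncate_seq_def)
    then show ?thesis unfolding eventually_sequentially by blast
  qed simp
  then have "\<forall>\<^sub>F K in sequentially. \<forall>g\<in>F. \<forall>h\<in>F. g \<noteq> h \<longrightarrow> truncate_seq K g \<noteq> truncate_seq K h"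
    using assms by (simp add: eventually_ball_finite)
  then obtain K where "\<forall>g\<in>F. \<forall>h\<in>F. g \<noteq> h \<longrightarrow> truncate_seq K g \<noteq> truncate_seq K h"
    unfolding eventually_sequentially by blast
  then show ?thesis by (auto simp: inj_on_def)
qed

lemma truncate_seq_hom:
  "truncate_seq K \<in> hom twisted_group (perm_prod (\<lambda>k. if k \<le> K then window k else {}))"
  using elements_permutes by (auto simp: hom_def truncate_seq_def fun_eq_iff)

lemma finite_truncate_seq: "finite (carrier (perm_prod (\<lambda>k. if k \<le> K then window k else {})))"
  by (rule finite_perm_prod[of _ K]) auto

section \<open>Approximation by finite groups\<close>

text \<open>Forgets the action on the second copy. It is multiplicative only on maps that preserve
  the copies, so it is applied to the finitary part and not to the rotation, which crosses between
  copies.\<close>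

definition keep_True :: "(site \<Rightarrow> site) \<Rightarrow> site \<Rightarrow> site" where
  "keep_True p w = (if snd w then p w else w)"

lemma keep_True_comp:
  assumes "\<And>w. snd (q w) = snd w"
  shows "keep_True (p \<circ> q) = keep_True p \<circ> keep_True q"
  using assms by (auto simp: keep_True_def)

lemma keep_True_shift:
  "keep_True (shift (- f) \<circ> p \<circ> shift f) = shift (- f) \<circ> keep_True p \<circ> shift f"
  by (auto simp: keep_True_def shift_def)

lemma keep_True_permutes:
  assumes p: "p permutes window K" and snd: "\<And>w. snd (p w) = snd w"
  shows "keep_True p permutes window K"
proof (rule permutes_altdef[THEN iffD2], intro conjI)
  define q where "q = inv_into UNIV p"
  have pq: "p (q w) = w" "q (p w) = w" for w
    using permutes_inverses[OF p] by (simp_all add: q_def)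
  have snd_q: "snd (q w) = snd w" for w using snd[of "q w"] by (simp add: pq)
  have pW: "p w \<in> window K \<longleftrightarrow> w \<in> window K" and qW: "q w \<in> window K \<longleftrightarrow> w \<in> window K" for w
    using permutes_in_image[OF p] permutes_in_image[OF permutes_inv[OF p]] by (simp_all only: q_def)
  show "bij_betw (keep_True p) (window K) (window K)"
    by (intro bij_betw_byWitness[where f' = "keep_True q"])
      (auto simp: keep_True_def pq snd snd_q pW qW simp del: window_iff)
  show "{w. keep_True p w \<noteq> w} \<subseteq> window K"
    using permutes_not_in[OF p] by (auto simp: keep_True_def simp del: window_iff split: if_splits)
qed

definition exponent :: "(nat \<Rightarrow> site \<Rightarrow> site) \<Rightarrow> int" where
  "exponent x = (THE e. \<exists>p. stable_form x e p)"

definition finitary_part :: "(nat \<Rightarrow> site \<Rightarrow> site) \<Rightarrow> site \<Rightarrow> site" where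
  "finitary_part x = (THE p. \<exists>e. stable_form x e p)"

lemma stable_form_parts:
  assumes "stable_form x e p"
  shows "exponent x = e" "finitary_part x = p"
  unfolding exponent_def finitary_part_def
  using assms stable_form_unique by (blast intro!: the_equality)+

text \<open>The symmetric group of \<open>window n\<close>, written as a product with one nontrivial
  factor so that \<open>perm_prod\<close> applies.\<close>

definition approx_group :: "nat \<Rightarrow> (nat \<Rightarrow> site \<Rightarrow> site) monoid" where
  "approx_group n = perm_prod (\<lambda>k. if k = n then window n else {})"

text \<open>The identity is a default for an \<open>n\<close> whose window is too small for the
  finitary part of \<open>x\<close>. For a given element of the group this happens for finitely many
  \<open>n\<close>.\<close>

definition approx :: "nat \<Rightarrow> (nat \<Rightarrow> site \<Rightarrow> site) \<Rightarrow> nat \<Rightarrow> site \<Rightarrow> site" where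
  "approx n x k = (if k = n \<and> finitary_part x permutes window n
     then rot (exponent x) n \<circ> keep_True (finitary_part x) else id)"

lemma approx_stable_form:
  assumes "stable_form x e p" "p permutes window n"
  shows "approx n x = (\<lambda>k. if k = n then rot e n \<circ> keep_True p else id)"
  by (rule ext) (simp add: approx_def stable_form_parts[OF assms(1)] assms(2))

lemma group_approx_group: "group (approx_group n)"
  unfolding approx_group_def by (rule group_perm_prod)

lemma finite_approx_group: "finite (carrier (approx_group n))"
  unfolding approx_group_def by (rule finite_perm_prod[of _ n]) auto

lemma approx_in_approx_group:
  assumes "x \<in> elements"
  shows "approx n x \<in> carrier (approx_group n)"
proof -
  obtain e p where "stable_form x e p" using stable_form_exists[OF assms] by blast
  then have snd: "snd (finitary_part x w) = snd w" for w
    using stable_form_parts stable_form_snd by metis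
  have "approx n x k permutes (if k = n then window n else {})" for k
    using permutes_compose[OF keep_True_permutes[OF _ snd] rot_permutes]
    by (simp add: approx_def permutes_id)
  then show ?thesis by (simp add: approx_group_def)
qed

text \<open>For large \<open>n\<close> the product formula for stable forms involves only
  conjugation by shifts. Shifts preserve the copies, so \<open>keep_True\<close> passes through the
  formula.\<close>

lemma approx_mult:
  assumes "x \<in> elements" "y \<in> elements"
  shows "\<forall>\<^sub>F n in sequentially. approx n (\<lambda>k. x k \<circ> y k) = (\<lambda>k. approx n x k \<circ> approx n y k)"
proof -
  obtain e p where x: "stable_form x e p" using stable_form_exists[OF assms(1)] by blast
  obtain f q where y: "stable_form y f q" using stable_form_exists[OF assms(2)] by blast
  define r where "r = shift (- f) \<circ> p \<circ> shift f \<circ> q"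
  have xy: "stable_form (\<lambda>k. x k \<circ> y k) (e + f) r"
    unfolding r_def by (rule stable_form_mult[OF x y])
  obtain K1 where K1: "p permutes window K1" using x unfolding stable_form_def by blast
  obtain K2 where K2: "q permutes window K2" using y unfolding stable_form_def by blast
  obtain K3 where K3: "r permutes window K3" using xy unfolding stable_form_def by blast
  obtain K4 where K4: "\<And>k. k \<ge> K4 \<Longrightarrow> half K1 + \<bar>f\<bar> \<le> half k" using half_unbounded by blast
  have "approx n (\<lambda>k. x k \<circ> y k) = (\<lambda>k. approx n x k \<circ> approx n y k)"
    if n: "n \<ge> K1" "n \<ge> K2" "n \<ge> K3" "n \<ge> K4" for n
  proof -
    have "keep_True r = shift (- f) \<circ> keep_True p \<circ> shift f \<circ> keep_True q"
      unfolding r_def keep_True_comp[of q, OF stable_form_snd[OF y]] keep_True_shift by (rule refl)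
    also have "shift (- f) \<circ> keep_True p \<circ> shift f = rot (- f) n \<circ> keep_True p \<circ> rot f n"
      using keep_True_permutes[OF K1 stable_form_snd[OF x]] K4[OF n(4)] by (rule rot_conj_finitary[symmetric])
    finally have "rot (e + f) n \<circ> keep_True r = (rot e n \<circ> keep_True p) \<circ> (rot f n \<circ> keep_True q)"
      by (simp add: rot_add fun_eq_iff)
    moreover have "p permutes window n" "q permutes window n" "r permutes window n"
      using n K1 K2 K3 permutes_subset window_mono by metis+
    ultimately show ?thesis
      by (simp add: approx_stable_form[OF x] approx_stable_form[OF y] approx_stable_form[OF xy] fun_eq_iff)
  qed
  then show ?thesis
    unfolding eventually_sequentially
    by (intro exI[of _ "max (max K1 K2) (max K3 K4)"]) simp
qed

section \<open>Adjacent transpositions and 3-cycles\<close>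

text \<open>The transposition of neighbouring sites reached from 0 in copy \<open>b\<close> by
  \<open>m\<close> and \<open>m + 1\<close> steps along the glued cycle; for large \<open>m\<close>
  these may lie in the other copy.\<close>

definition adj_swap :: "int \<Rightarrow> bool \<Rightarrow> nat \<Rightarrow> site \<Rightarrow> site" where
  "adj_swap m b k = rot m k \<circ> swap b k \<circ> rot (- m) k"

lemma adj_swap_eq: "adj_swap m b k = Transposition.transpose (rot m k (0, b)) (rot (m + 1) k (0, b))"
proof -
  have "rot 1 k (0, b) = (1, b)" using half_ge[of k] by (simp add: rot_near)
  then show ?thesis
    unfolding adj_swap_def swap_def rot_conj_transpose by (simp add: rot_add)
qed

lemma adj_swap_in_elements: "adj_swap m b \<in> elements"
  unfolding adj_swap_def[abs_def] by (intro elements_mult rot_in_elements swap_in_elements)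

lemma adj_swap_involution [simp]: "adj_swap m b k (adj_swap m b k w) = w"
  by (simp add: adj_swap_eq)

lemma rot_conj_adj_swap: "rot m k \<circ> adj_swap l b k \<circ> rot (- m) k = adj_swap (m + l) b k"
  unfolding adj_swap_eq rot_conj_transpose by (simp add: rot_add add.assoc)

definition cycle :: "int \<Rightarrow> bool \<Rightarrow> nat \<Rightarrow> site \<Rightarrow> site" where
  "cycle m b k = adj_swap m b k \<circ> adj_swap (m + 1) b k"

definition cycle_inv :: "int \<Rightarrow> bool \<Rightarrow> nat \<Rightarrow> site \<Rightarrow> site" where
  "cycle_inv m b k = adj_swap (m + 1) b k \<circ> adj_swap m b k"

lemma cycle_in_elements: "cycle m b \<in> elements" "cycle_inv m b \<in> elements"
  unfolding cycle_def[abs_def] cycle_inv_def[abs_def] by (intro elements_mult adj_swap_in_elements)+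

lemma cycle_cycle_inv [simp]: "cycle m b k (cycle_inv m b k w) = w"
  by (simp add: cycle_def cycle_inv_def)

lemma cycle_inv_cycle [simp]: "cycle_inv m b k (cycle m b k w) = w"
  by (simp add: cycle_def cycle_inv_def)

lemma rot_conj_cycle: "rot m k \<circ> cycle l b k \<circ> rot (- m) k = cycle (m + l) b k"
proof -
  have "rot m k \<circ> cycle l b k \<circ> rot (- m) k
      = (rot m k \<circ> adj_swap l b k \<circ> rot (- m) k) \<circ> (rot m k \<circ> adj_swap (l + 1) b k \<circ> rot (- m) k)"
    by (simp add: cycle_def fun_eq_iff)
  then show ?thesis unfolding rot_conj_adj_swap by (simp add: cycle_def add.assoc)
qed

lemma cycle_0:
  "cycle 0 b = (\<lambda>k. Transposition.transpose (0, b) (1, b) \<circ> Transposition.transpose (1, b) (2, b))"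
proof
  fix k
  have "rot 1 k (0, b) = (1, b)" "rot 2 k (0, b) = (2, b)"
    using half_ge[of k] by (simp_all add: rot_near)
  then show "cycle 0 b k = Transposition.transpose (0, b) (1, b) \<circ> Transposition.transpose (1, b) (2, b)"
    by (simp add: cycle_def adj_swap_eq rot_0)
qed

lemma stable_form_cycle_0:
  "stable_form (cycle 0 b) 0 (Transposition.transpose (0, b) (1, b) \<circ> Transposition.transpose (1, b) (2, b))"
  unfolding cycle_0
proof (rule stable_form_const[of _ 0])
  show "Transposition.transpose (0, b) (1, b) \<circ> Transposition.transpose (1, b) (2, b) permutes window 0"
    by (intro permutes_compose permutes_swap_id) (auto simp: half_0)
  have "snd (Transposition.transpose (i, b) (j, b) w) = snd w" for i j and w :: site
    by (cases w) (simp add: Transposition.transpose_def)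
  then show "snd ((Transposition.transpose (0, b) (1, b) \<circ> Transposition.transpose (1, b) (2, b)) w) = snd w"
    for w :: site by simp
qed

lemma cycle_0_permutes:
  "Transposition.transpose (0, b) (1, b) \<circ> Transposition.transpose (1, b) (2, b) permutes window n"
  using elements_permutes[OF cycle_in_elements(1)[of 0 b], of n] by (simp only: cycle_0)

lemma approx_cycle_True: "approx n (cycle 0 True) \<noteq> \<one>\<^bsub>approx_group n\<^esub>"
proof
  assume "approx n (cycle 0 True) = \<one>\<^bsub>approx_group n\<^esub>"
  then have "approx n (cycle 0 True) n (2, True) = (2, True)" by (simp add: approx_group_def)
  then show False
    unfolding approx_stable_form[OF stable_form_cycle_0 cycle_0_permutes]
    by (simp add: rot_0 keep_True_def)
qed

lemma approx_cycle_False: "approx n (cycle 0 False) = \<one>\<^bsub>approx_group n\<^esub>"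
  unfolding approx_stable_form[OF stable_form_cycle_0 cycle_0_permutes]
  by (auto simp: fun_eq_iff approx_group_def rot_0 keep_True_def Transposition.transpose_def)

section \<open>Elements killed by finite-dimensional representations\<close>

text \<open>By \<open>rot_flip\<close>, on \<open>window k\<close> with \<open>k \<le> i\<close> the two cycles below coincide, whereas for \<open>k > i\<close>
  they have disjoint supports.\<close>

definition obstruction :: "nat \<Rightarrow> nat \<Rightarrow> site \<Rightarrow> site" where
  "obstruction i k = cycle_inv (period i + 3 * int i) True k \<circ> cycle (3 * int i) False k"

text \<open>Each factor swaps two of the three points of one of the cycles in
  \<open>obstruction i\<close>, so conjugation by it inverts that cycle, as in a dihedral group of
  order 6.\<close>

definition inverter :: "nat \<Rightarrow> nat \<Rightarrow> site \<Rightarrow> site" where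
  "inverter i k = adj_swap (period i + 3 * int i) True k \<circ> adj_swap (3 * int i) False k"

lemma obstruction_in_elements: "obstruction i \<in> elements" "inverter i \<in> elements"
  unfolding obstruction_def[abs_def] inverter_def[abs_def]
  by (intro elements_mult cycle_in_elements adj_swap_in_elements)+

lemma obstruction_trivial:
  assumes "k \<le> i"
  shows "obstruction i k = id"
proof -
  have "(0, True) \<in> window k" using half_nonneg by simp
  from rot_flip[OF assms this] have "rot (period i) k (0, True) = (0, False)" by simp
  then have "rot (period i + m) k (0, True) = rot m k (0, False)" for m
    by (simp add: add.commute[of "period i"] rot_add)
  then have eq: "adj_swap (period i + m) True k = adj_swap m False k" for m
    unfolding adj_swap_eq add.assoc by simp
  then show ?thesis
    unfolding obstruction_def cycle_inv_def cycle_def add.assoc eq by (intro ext) simp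
qed

text \<open>\<open>period i\<close> and \<open>half i\<close> add up to the half-length of the next
  window, and \<open>half i\<close> exceeds \<open>3 * int i + 2\<close>. The three sites used in
  the first copy thus fit without wrapping.\<close>

lemma room_after_period:
  assumes "i < k"
  shows "period i + 3 * int i + 2 \<le> half k"
proof -
  have "period i + half i = half (Suc i)" by (simp add: half_Suc period_eq)
  also have "\<dots> \<le> half k" using assms by (intro half_mono) simp
  finally show ?thesis using half_ge[of i] by simp
qed

lemma adj_swap_near:
  assumes "0 \<le> m" "m + 1 \<le> half k"
  shows "adj_swap m b k = Transposition.transpose (m, b) (m + 1, b)"
  using assms by (simp add: adj_swap_eq rot_near)

lemma obstruction_near:
  assumes "i < k"
  defines "N \<equiv> period i + 3 * int i" and "j \<equiv> 3 * int i"
  shows "obstruction i k =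
      (Transposition.transpose (N + 1, True) (N + 2, True) \<circ> Transposition.transpose (N, True) (N + 1, True))
      \<circ> (Transposition.transpose (j, False) (j + 1, False) \<circ> Transposition.transpose (j + 1, False) (j + 2, False))"
    and "inverter i k =
      Transposition.transpose (N, True) (N + 1, True) \<circ> Transposition.transpose (j, False) (j + 1, False)"
proof -
  have N: "0 \<le> N" "N + 2 \<le> half k" "0 \<le> j" "j < N"
    unfolding N_def j_def using room_after_period[OF assms(1)] period_pos[of i] by linarith+
  then show "obstruction i k =
      (Transposition.transpose (N + 1, True) (N + 2, True) \<circ> Transposition.transpose (N, True) (N + 1, True))
      \<circ> (Transposition.transpose (j, False) (j + 1, False) \<circ> Transposition.transpose (j + 1, False) (j + 2, False))"
    "inverter i k =
      Transposition.transpose (N, True) (N + 1, True) \<circ> Transposition.transpose (j, False) (j + 1, False)"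
    unfolding obstruction_def inverter_def cycle_def cycle_inv_def
    unfolding N_def[symmetric]
    unfolding j_def[symmetric]
    by (simp_all add: adj_swap_near add.commute[of _ 2])
qed

text \<open>\<open>Q\<close> is a product of two disjoint 3-cycles, running in opposite directions
  because one factor of the obstruction is an inverse cycle. Conjugation by \<open>V\<close>, which
  fixes \<open>a2\<close> and \<open>b2\<close>, inverts both. It suffices to check the six
  points.\<close>

lemma two_cycles_relations:
  fixes a0 a1 a2 b0 b1 b2 :: 'a
  assumes "distinct [a0, a1, a2, b0, b1, b2]"
  defines "Q \<equiv> (Transposition.transpose a1 a2 \<circ> Transposition.transpose a0 a1) \<circ> (Transposition.transpose b0 b1 \<circ> Transposition.transpose b1 b2)"
    and "V \<equiv> Transposition.transpose a0 a1 \<circ> Transposition.transpose b0 b1"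
  shows "Q \<circ> (Q \<circ> Q) = id" "V \<circ> Q = Q \<circ> Q \<circ> V"
proof -
  have Q: "Q a0 = a2" "Q a1 = a0" "Q a2 = a1" "Q b0 = b1" "Q b1 = b2" "Q b2 = b0"
    and V: "V a0 = a1" "V a1 = a0" "V a2 = a2" "V b0 = b1" "V b1 = b0" "V b2 = b2"
    using assms(1) by (auto simp: Q_def V_def Transposition.transpose_def)
  have other: "Q w = w" "V w = w" if "w \<notin> {a0, a1, a2, b0, b1, b2}" for w
    using that by (auto simp: Q_def V_def)
  have "Q (Q (Q w)) = w" for w
    using other[of w] by (cases "w \<in> {a0, a1, a2, b0, b1, b2}") (auto simp: Q)
  then show "Q \<circ> (Q \<circ> Q) = id" by (simp add: fun_eq_iff)
  have "V (Q w) = Q (Q (V w))" for w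
    using other[of w] by (cases "w \<in> {a0, a1, a2, b0, b1, b2}") (auto simp: Q V)
  then show "V \<circ> Q = Q \<circ> Q \<circ> V" by (simp add: fun_eq_iff)
qed

lemma obstruction_relations:
  "obstruction i k \<circ> (obstruction i k \<circ> obstruction i k) = id"
  "inverter i k \<circ> obstruction i k = obstruction i k \<circ> obstruction i k \<circ> inverter i k"
proof -
  have "obstruction i k \<circ> (obstruction i k \<circ> obstruction i k) = id \<and>
    inverter i k \<circ> obstruction i k = obstruction i k \<circ> obstruction i k \<circ> inverter i k"
  proof (cases "k \<le> i")
    case True
    then show ?thesis by (simp add: obstruction_trivial)
  next
    case False
    then have ik: "i < k" by simp
    show ?thesis
      unfolding obstruction_near[OF ik] by (intro conjI two_cycles_relations) auto
  qed
  then show "obstruction i k \<circ> (obstruction i k \<circ> obstruction i k) = id"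
    "inverter i k \<circ> obstruction i k = obstruction i k \<circ> obstruction i k \<circ> inverter i k" by auto
qed

lemma transposes_commute:
  assumes "a \<noteq> c" "a \<noteq> d" "b \<noteq> c" "b \<noteq> d"
  shows "Transposition.transpose a b (Transposition.transpose c d w) = Transposition.transpose c d (Transposition.transpose a b w)"
  using assms by (auto simp: Transposition.transpose_def)

lemma period_strict_mono: "i < j \<Longrightarrow> period i < period j"
  by (simp add: period_def)

text \<open>Up to \<open>window j\<close> the obstruction is trivial. On larger windows the supports
  are disjoint, since the offset \<open>3 * int i\<close> and the growth of \<open>period\<close>
  put different indices on different triples in each copy.\<close>

lemma inverter_commutes:
  assumes "i < j"
  shows "inverter i k \<circ> obstruction j k = obstruction j k \<circ> inverter i k"
proof (cases "k \<le> j")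
  case True
  then show ?thesis by (simp add: obstruction_trivial)
next
  case False
  then have k: "j < k" "i < k" using assms by simp_all
  have "period i < period j" using assms by (rule period_strict_mono)
  then show ?thesis
    unfolding obstruction_near(1)[OF k(1)] obstruction_near(2)[OF k(2)]
    using assms by (simp add: fun_eq_iff transposes_commute)
qed

section \<open>Traces of finite-dimensional representations\<close>

lemma hom_twistedD:
  assumes "\<pi> \<in> hom twisted_group (unitary_group n)"
  shows "x \<in> elements \<Longrightarrow> \<pi> x \<in> carrier (unitary_group n)"
    and "x \<in> elements \<Longrightarrow> y \<in> elements \<Longrightarrow> \<pi> (\<lambda>k. x k \<circ> y k) = \<pi> x * \<pi> y"
  using assms by (auto simp: hom_def)

text \<open>\<open>cycle m b\<close> is conjugate to \<open>cycle 0 b\<close> by a rotation, and the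
  trace is invariant under conjugation.\<close>

lemma trace_cycle_shift:
  assumes \<pi>: "\<pi> \<in> hom twisted_group (unitary_group n)"
  shows "mat_trace (\<pi> (cycle m b)) = mat_trace (\<pi> (cycle 0 b))"
proof -
  note U = unitary_groupD(1)[OF hom_twistedD(1)[OF \<pi>]] and mult = hom_twistedD(2)[OF \<pi>]
  let ?c = "cycle 0 b"
  have "(\<lambda>k. rot m k \<circ> ?c k) \<in> elements"
    by (intro elements_mult rot_in_elements cycle_in_elements)
  then have "\<pi> (\<lambda>k. (rot m k \<circ> ?c k) \<circ> rot (- m) k) = \<pi> (\<lambda>k. rot m k \<circ> ?c k) * \<pi> (rot (- m))"
    by (rule mult[OF _ rot_in_elements])
  also have "(\<lambda>k. (rot m k \<circ> ?c k) \<circ> rot (- m) k) = cycle m b"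
    unfolding rot_conj_cycle by simp
  finally have "mat_trace (\<pi> (cycle m b)) = mat_trace (\<pi> (rot (- m)) * \<pi> (\<lambda>k. rot m k \<circ> ?c k))"
    using mat_trace_comm[OF U[OF elements_mult[OF rot_in_elements cycle_in_elements(1)]] U[OF rot_in_elements]]
    by (simp only:)
  also have "\<pi> (rot (- m)) * \<pi> (\<lambda>k. rot m k \<circ> ?c k) = \<pi> (\<lambda>k. rot (- m) k \<circ> (rot m k \<circ> ?c k))"
    by (intro mult[symmetric] elements_mult rot_in_elements cycle_in_elements)
  also have "(\<lambda>k. rot (- m) k \<circ> (rot m k \<circ> ?c k)) = ?c"
    by (intro ext) simp
  finally show ?thesis .
qed

text \<open>Once \<pi> kills \<open>obstruction i\<close>, the two cycles from which it is built
  have the same image. One is conjugate to \<open>cycle 0 True\<close> and the other to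
  \<open>cycle 0 False\<close>.\<close>

lemma trace_cycles_agree:
  assumes \<pi>: "\<pi> \<in> hom twisted_group (unitary_group n)"
  shows "mat_trace (\<pi> (cycle 0 True)) = mat_trace (\<pi> (cycle 0 False))"
proof -
  have "\<exists>i. \<pi> (obstruction i) = 1\<^sub>m n"
  proof (rule finite_dim_rep_kills[OF group_twisted \<pi>, where v = inverter])
    show "obstruction i \<in> carrier twisted_group" "inverter i \<in> carrier twisted_group" for i
      by (simp_all add: obstruction_in_elements)
    show "obstruction i \<otimes>\<^bsub>twisted_group\<^esub> (obstruction i \<otimes>\<^bsub>twisted_group\<^esub> obstruction i) = \<one>\<^bsub>twisted_group\<^esub>" for i
      using obstruction_relations(1)[of i] by (simp add: fun_eq_iff)
    show "inverter i \<otimes>\<^bsub>twisted_group\<^esub> obstruction i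
        = obstruction i \<otimes>\<^bsub>twisted_group\<^esub> obstruction i \<otimes>\<^bsub>twisted_group\<^esub> inverter i" for i
      by (simp add: obstruction_relations(2))
    show "inverter i \<otimes>\<^bsub>twisted_group\<^esub> obstruction j = obstruction j \<otimes>\<^bsub>twisted_group\<^esub> inverter i"
      if "i < j" for i j
      by (simp add: inverter_commutes[OF that])
  qed
  then obtain i where i: "\<pi> (obstruction i) = 1\<^sub>m n" by blast
  define M where "M = period i + 3 * int i"
  note U = unitary_groupD(1)[OF hom_twistedD(1)[OF \<pi>]] and mult = hom_twistedD(2)[OF \<pi>]
  have "(\<lambda>k. cycle M True k \<circ> obstruction i k) = cycle (3 * int i) False"
    by (intro ext) (simp add: obstruction_def M_def)
  then have "\<pi> (cycle (3 * int i) False) = \<pi> (cycle M True) * \<pi> (obstruction i)"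
    using mult[OF cycle_in_elements(1) obstruction_in_elements(1), of M True i] by simp
  also have "\<dots> = \<pi> (cycle M True)"
    unfolding i using U[OF cycle_in_elements(1)] by (rule right_mult_one_mat)
  finally show ?thesis
    using trace_cycle_shift[OF \<pi>, of "3 * int i" False] trace_cycle_shift[OF \<pi>, of M True] by simp
qed

lemma not_flexibly_stable_twisted: "\<not> flexibly_stable twisted_group"
proof (rule not_flexibly_stable_if_traces_agree[where x = "cycle 0 True" and y = "cycle 0 False"
      and \<alpha> = approx and Q = approx_group])
  show "\<forall>\<^sub>F n in sequentially. approx n (g \<otimes>\<^bsub>twisted_group\<^esub> h) = approx n g \<otimes>\<^bsub>approx_group n\<^esub> approx n h"
    if "g \<in> carrier twisted_group" "h \<in> carrier twisted_group" for g h
    using approx_mult[of g h] that by (simp add: approx_group_def)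
qed (use trace_cycles_agree group_twisted group_approx_group finite_approx_group approx_in_approx_group
    approx_cycle_True approx_cycle_False cycle_in_elements in auto)

lemma very_flexibly_stable_twisted: "very_flexibly_stable twisted_group"
proof (rule very_flexibly_stable_if_foelner[OF group_twisted])
  show "countable (carrier twisted_group)" by (simp add: countable_elements)
  fix K and \<epsilon> :: real
  assume K: "finite K" "K \<subseteq> carrier twisted_group" "\<epsilon> > 0"
  then have "K \<subseteq> elements" by simp
  then obtain F where F: "finite F" "F \<noteq> {}" "F \<subseteq> elements"
    "\<forall>g\<in>K. real (card {f\<in>F. (\<lambda>k. g k \<circ> f k) \<notin> F}) \<le> \<epsilon> * real (card F)"
    using foelner_sets[OF K(1) _ K(3)] by blast
  obtain L where "inj_on (truncate_seq L) F" using truncate_seq_separates[OF F(1)] by blast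
  then show "\<exists>F (Q :: (nat \<Rightarrow> site \<Rightarrow> site) monoid) \<theta>. finite F \<and> F \<noteq> {} \<and> F \<subseteq> carrier twisted_group \<and>
      (\<forall>g\<in>K. real (card {f\<in>F. g \<otimes>\<^bsub>twisted_group\<^esub> f \<notin> F}) \<le> \<epsilon> * real (card F)) \<and>
      group Q \<and> finite (carrier Q) \<and> \<theta> \<in> hom twisted_group Q \<and> inj_on \<theta> F"
    using F truncate_seq_hom[of L] finite_truncate_seq[of L] group_perm_prod
    by (intro exI[of _ F] exI[of _ "perm_prod (\<lambda>k. if k \<le> L then window k else {})"] exI[of _ "truncate_seq L"])
      simp
qed

section \<open>Transport to a group on the natural numbers\<close>

lemma asymptotic_representation_comp:
  assumes "f \<in> hom G H" "asymptotic_representation H d \<phi>"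
  shows "asymptotic_representation G d (\<lambda>n. \<phi> n \<circ> f)"
  using assms(2) hom_in_carrier[OF assms(1)] hom_mult[OF assms(1)]
  unfolding asymptotic_representation_def by (auto simp: Pi_iff)

lemma asymptotically_compresses_comp:
  assumes f': "f' \<in> hom H G" and inverse: "\<And>y. y \<in> carrier H \<Longrightarrow> f (f' y) = y"
    and compress: "asymptotically_compresses G d (\<lambda>n. \<phi> n \<circ> f) k W \<pi>"
  shows "asymptotically_compresses H d \<phi> k W (\<lambda>n. \<pi> n \<circ> f')"
  unfolding asymptotically_compresses_def
proof (intro conjI allI ballI)
  show "d n \<le> k n" "W n \<in> isometry_mats (d n) (k n)" for n
    using compress unfolding asymptotically_compresses_def by auto
  show "\<pi> n \<circ> f' \<in> hom H (unitary_group (k n))" for n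
    using compress f' unfolding asymptotically_compresses_def by (blast intro: hom_compose)
  fix g assume g: "g \<in> carrier H"
  have "f' g \<in> carrier G" using hom_in_carrier[OF f' g] .
  then have "(\<lambda>n. op_norm (mat_adjoint (W n) * \<pi> n (f' g) * W n - (\<phi> n \<circ> f) (f' g))) \<longlonglongrightarrow> 0"
    using compress unfolding asymptotically_compresses_def by blast
  then show "(\<lambda>n. op_norm (mat_adjoint (W n) * (\<pi> n \<circ> f') g * W n - \<phi> n g)) \<longlonglongrightarrow> 0"
    using g by (simp add: inverse)
qed

text \<open>An asymptotic representation of \<open>H\<close> is pulled back to \<open>G\<close>
  along \<open>f\<close>, dilated there, and the dilations are pulled back to \<open>H\<close> along
  \<open>f'\<close>.\<close>

lemma stability_transfer:
  assumes "f \<in> hom G H" "f' \<in> hom H G" "\<And>y. y \<in> carrier H \<Longrightarrow> f (f' y) = y"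
  shows "very_flexibly_stable G \<Longrightarrow> very_flexibly_stable H"
    and "flexibly_stable G \<Longrightarrow> flexibly_stable H"
  unfolding very_flexibly_stable_def flexibly_stable_def
  using asymptotic_representation_comp[OF assms(1)] asymptotically_compresses_comp[OF assms(2,3)]
  by meson+

text \<open>The group law is transported along an injection of the carrier into the natural numbers,
  to reach a carrier of the type that the theorem asks for.\<close>

lemma countable_group_on_nat:
  fixes G :: "('a, 'b) monoid_scheme"
  assumes "group G" "countable (carrier G)"
  obtains H :: "nat monoid" and f f' where "group H" "f \<in> hom G H" "f' \<in> hom H G" "f ` carrier G = carrier H"
    "\<And>x. x \<in> carrier G \<Longrightarrow> f' (f x) = x" "\<And>y. y \<in> carrier H \<Longrightarrow> f (f' y) = y"
proof -
  interpret group G by fact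
  define f where "f = to_nat_on (carrier G)"
  define f' where "f' = from_nat_into (carrier G)"
  define H :: "nat monoid" where
    "H = \<lparr>carrier = f ` carrier G, monoid.mult = \<lambda>x y. f (f' x \<otimes>\<^bsub>G\<^esub> f' y), one = f \<one>\<^bsub>G\<^esub>\<rparr>"
  have f'f: "f' (f x) = x" if "x \<in> carrier G" for x
    using assms(2) that by (simp add: f_def f'_def)
  have H: "group H"
  proof (rule groupI)
    fix x assume "x \<in> carrier H"
    then obtain a where "a \<in> carrier G" "x = f a" by (auto simp: H_def)
    then show "\<exists>y\<in>carrier H. y \<otimes>\<^bsub>H\<^esub> x = \<one>\<^bsub>H\<^esub>"
      by (intro bexI[of _ "f (inv\<^bsub>G\<^esub> a)"]) (auto simp: H_def f'f)
  qed (auto simp: H_def f'f m_assoc)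
  show thesis
    by (rule that[OF H, of f f']) (auto simp: H_def hom_def f'f)
qed

theorem theorem3:
  shows "\<exists>G :: nat monoid. group G \<and> finitely_generated G \<and>
    very_flexibly_stable G \<and> \<not> flexibly_stable G"
proof -
  have "countable (carrier twisted_group)" by (simp add: countable_elements)
  then obtain H :: "nat monoid" and f f' where H: "group H" and f: "f \<in> hom twisted_group H"
    and f': "f' \<in> hom H twisted_group" and image: "f ` carrier twisted_group = carrier H"
    and f'f: "\<And>x. x \<in> carrier twisted_group \<Longrightarrow> f' (f x) = x"
    and ff': "\<And>y. y \<in> carrier H \<Longrightarrow> f (f' y) = y"
    using countable_group_on_nat[OF group_twisted] by metis
  interpret f: group_hom twisted_group H f
    by (intro group_hom.intro group_hom_axioms.intro group_twisted H f)
  obtain S where S: "finite S" "S \<subseteq> carrier twisted_group" "generate twisted_group S = carrier twisted_group"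
    using finitely_generated_twisted unfolding finitely_generated_def by blast
  have "finitely_generated H"
    unfolding finitely_generated_def
  proof (intro exI[of _ "f ` S"] conjI)
    show "generate H (f ` S) = carrier H"
      using f.generate_img[OF S(2)] S(3) image by simp
  qed (use S image in blast)+
  moreover have "very_flexibly_stable H"
    by (rule stability_transfer(1)[OF f f' ff' very_flexibly_stable_twisted])
  moreover have "\<not> flexibly_stable H"
    using stability_transfer(2)[OF f' f f'f] not_flexibly_stable_twisted by blast
  ultimately show ?thesis using H by blast
qed

end
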